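(* Let $n\ge4$. Let $G_n$ be the full subgroup of the orthogonal group $O(\mathbb{R}^n)$ stabilizing $h\gamma_n$ setwise, and consider $W(D_n)$ as a subgroup of $G_n$ via its action on $\mathbb{R}^n$ by signed permutations of coordinates. (i) The groups $W(D_n)$ and $G_n$ permute the $k$-faces of $h\gamma_n$ for each $k$. (ii) If $n>4$, the $G_n$-orbits of $k$-faces coincide with the $W(D_n)$-orbits. There are two orbits of $k$-faces for $3\le k<n$, and one orbit of $k$-faces otherwise. In the case where there are two orbits, the orbits are distinguished by whether the face corresponds to a set $K(\mathbf{v}',S)$ (i.e. is $\Pi(K(\mathbf{v}',S))$ with $\mathbf{v}'\in\Psi^-_n$, $|S|=k+1$) or to a set $L(\mathbf{v},S)$ (i.e. is $\Pi(L(\mathbf{v},S))$ with $\mathbf{v}\in\Psi^+_n$, $|S|=k$). (iii) If $n=4$, there is one $G_n$-orbit of $k$-faces for each $0\le k\le n$. The $W(D_n)$-orbits coincide with the $G_n$-orbits, except that there are two $W(D_n)$-orbits of $3$-faces; these are distinguished by whether they correspond to a set $K(\mathbf{v}',S)$ (with $|S|=4$) or a set $L(\mathbf{v},S)$ (with $|S|=3$). (iv) The groups $W(D_n)$ act naturally on the nonzero homology groups $H_{k-1}(C_{n,k})$ for all $3\le k\le n$.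
   Context: Let $\mathbf{n}=\{1,\ldots,n\}$. $\Psi_n=\{\pm1\}^n\subset\mathbb{R}^n$; $\Psi^+_n$ is the subset of points with an even number of negative coordinates and $\Psi^-_n=\Psi_n\setminus\Psi^+_n$. For $V\subset\mathbb{R}^n$ finite, $\Pi(V)$ is its convex hull. The half cube is $h\gamma_n=\Pi(\Psi^+_n)$; its $k$-faces ($0\le k\le n$) are its $k$-dimensional faces in the usual sense, with $h\gamma_n$ itself the $n$-face. For $\mathbf{v}'\in\Psi^-_n$ and nonempty $S\subseteq\mathbf{n}$, $K(\mathbf{v}',S)$ is the set of points of $\Psi^+_n$ that differ from $\mathbf{v}'$ in exactly one coordinate $i$, with $i\in S$. For $\mathbf{v}\in\Psi^+_n$ and $S\subseteq\mathbf{n}$, $L(\mathbf{v},S)$ is the set of points of $\Psi^+_n$ agreeing with $\mathbf{v}$ in the $i$-th coordinate for every $i\notin S$. $W(D_n)$ (the Coxeter group of type $D_n$, of order $2^{n-1}n!$) is the subgroup of the group $\mathbb{Z}_2\wr S_n$ of signed permutations of $n$ objects consisting of all elements that effect an even number of sign changes. $h\gamma_n$ is a regular CW complex whose set of cells $E$ consists of the vertices, the relative interiors of all $k$-faces for $0<k<n$, and the interior of $h\gamma_n$. For $3\le k\le n$, $C_{n,k}$ is the subcomplex whose cells are all $e\in E$ except those whose closure is $\Pi(L(\mathbf{v},S))$ for some $\mathbf{v}\in\Psi^+_n$ and $S\subseteq\mathbf{n}$ with $|S|\ge k$. Homology is integral. The natural action in (iv) is the one in which $g\in W(D_n)$, acting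 on $\mathbb{R}^n$, restricts to a self-homeomorphism of (the underlying space of) $C_{n,k}$ and acts on homology by the induced map $g_*$. *)

theory Defs
  imports "HOL-Analysis.Analysis" "HOL-Homology.Homology" "HOL-Algebra.Group_Action"
begin

text \<open>
  The dimension \<open>n\<close> is \<open>CARD('n)\<close>, and the elements of \<open>'n\<close> index the coordinates.
\<close>

definition Psi :: "(real ^ 'n) set" where
  "Psi = {v. \<forall>i. v $ i = 1 \<or> v $ i = -1}"

definition Psi_plus :: "(real ^ 'n) set" where
  "Psi_plus = {v \<in> Psi. even (card {i. v $ i < 0})}"

definition Psi_minus :: "(real ^ 'n) set" where
  "Psi_minus = Psi - Psi_plus"

definition half_cube :: "(real ^ 'n) set" where
  "half_cube = convex hull Psi_plus"

definition k_faces :: "nat \<Rightarrow> (real ^ 'n) set set" where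
  "k_faces k = {F. F face_of half_cube \<and> aff_dim F = int k}"

definition K_set :: "real ^ 'n \<Rightarrow> 'n set \<Rightarrow> (real ^ 'n) set" where
  "K_set v' S = {w \<in> Psi_plus. \<exists>i\<in>S. {j. w $ j \<noteq> v' $ j} = {i}}"

definition L_set :: "real ^ 'n \<Rightarrow> 'n set \<Rightarrow> (real ^ 'n) set" where
  "L_set v S = {w \<in> Psi_plus. \<forall>i. i \<notin> S \<longrightarrow> w $ i = v $ i}"

definition K_faces :: "nat \<Rightarrow> (real ^ 'n) set set" where
  "K_faces k = {convex hull (K_set v' S) | v' S. v' \<in> Psi_minus \<and> card S = k + 1}"

definition L_faces :: "nat \<Rightarrow> (real ^ 'n) set set" where
  "L_faces k = {convex hull (L_set v S) | v S. v \<in> Psi_plus \<and> card S = k}"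

definition orthogonal_group :: "(real ^ 'n \<Rightarrow> real ^ 'n) monoid" where
  "orthogonal_group =
    \<lparr>carrier = {g. orthogonal_transformation g}, mult = (\<circ>), one = id\<rparr>"

definition half_cube_group :: "(real ^ 'n \<Rightarrow> real ^ 'n) monoid" where
  "half_cube_group =
    orthogonal_group\<lparr>carrier := {g \<in> carrier orthogonal_group. g ` half_cube = half_cube}\<rparr>"

definition signed_perm :: "('n \<Rightarrow> real) \<Rightarrow> ('n \<Rightarrow> 'n) \<Rightarrow> real ^ 'n \<Rightarrow> real ^ 'n" where
  "signed_perm s p x = (\<chi> i. s i * x $ p i)"

text \<open>
  Signed permutations are identified with the linear maps by which they act; the sign vector
  \<open>s\<close> and the permutation \<open>p\<close> are determined by that map.
\<close>

definition WD :: "(real ^ 'n \<Rightarrow> real ^ 'n) monoid" where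
  "WD = orthogonal_group\<lparr>carrier :=
     {signed_perm s p | s p. bij p \<and> (\<forall>i. s i = 1 \<or> s i = -1) \<and> even (card {i. s i = -1})}\<rparr>"

text \<open>
  The action on \<open>k\<close>-faces by taking images, made extensional as required by
  \<^const>\<open>BijGroup\<close>.
\<close>

definition face_action :: "nat \<Rightarrow> (real ^ 'n \<Rightarrow> real ^ 'n) \<Rightarrow> (real ^ 'n) set \<Rightarrow> (real ^ 'n) set" where
  "face_action k g = (\<lambda>F \<in> k_faces k. g ` F)"

definition cells :: "(real ^ 'n) set set" where
  "cells = k_faces 0 \<union> {rel_interior F | F k. 0 < k \<and> k < CARD('n) \<and> F \<in> k_faces k}
     \<union> {interior half_cube}"

definition C_cells :: "nat \<Rightarrow> (real ^ 'n) set set" where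
  "C_cells k = {e \<in> cells.
     \<not> (\<exists>v S. v \<in> Psi_plus \<and> k \<le> card S \<and> closure e = convex hull (L_set v S))}"

text \<open>
  The underlying space of the subcomplex; the complex is finite, so the CW topology is the
  subspace topology.
\<close>

definition C_space :: "nat \<Rightarrow> (real ^ 'n) topology" where
  "C_space k = top_of_set (\<Union> (C_cells k))"

definition C_homology :: "nat \<Rightarrow> nat \<Rightarrow> (real ^ 'n) chain set monoid" where
  "C_homology p k = homology_group (int p) (C_space k)"

definition homology_action ::
    "nat \<Rightarrow> nat \<Rightarrow> (real ^ 'n \<Rightarrow> real ^ 'n) \<Rightarrow> (real ^ 'n) chain set \<Rightarrow> (real ^ 'n) chain set" where
  "homology_action p k g =
     (\<lambda>c \<in> carrier (C_homology p k). hom_induced (int p) (C_space k) {} (C_space k) {} g c)"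

end

theory Submission
  imports Defs
begin

text \<open>
Membership of a sign vector in \<open>Psi_plus\<close> is read off from the product of its coordinates, and any
two sign vectors differ by flipping a set of coordinates.  In these terms \<open>K_set v S\<close> consists of
the single flips of \<open>v\<close> at elements of \<open>S\<close>, and \<open>L_set v S\<close> of the flips of \<open>v\<close> at the even subsets
of \<open>S\<close>.

The faces of the half cube are found by linear programming (lemma \<open>half_cube_faces\<close>).  Every face of
a polytope is exposed, hence is the convex hull of the vertices that maximise a functional
\<open>x \<mapsto> a \<bullet> x\<close>.  If \<open>a\<close> has a zero coordinate, flipping it repairs the parity at no cost, so
the maximisers are the even vectors that agree with the signs of \<open>a\<close> wherever \<open>a\<close> is nonzero: a set
of type \<open>L\<close>.  If \<open>a\<close> has no zero coordinate, its sign vector either is even, and then is the only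
maximiser, or is odd, and then the cheapest repair flips one coordinate at which the weight is least
in absolute value: a set of type \<open>K\<close>.  Conversely all these sets span faces, of dimension
\<open>card S - 1\<close> for type \<open>K\<close> and \<open>card S\<close> for type \<open>L\<close> with \<open>card S \<ge> 3\<close>; a set of type \<open>L\<close> with at
most two free coordinates is also of type \<open>K\<close>.

Even signed permutations act transitively on the pairs of a sign vector of given parity and a set of
coordinates of given size, so each type and dimension is a single orbit under \<open>W(D\<^sub>n)\<close>, and the two
types are different.  For \<open>n > 4\<close> an isometry of the half cube cannot exchange the types
(lemma \<open>half_cube_group_not_K_to_L\<close>): when \<open>k \<ge> 4\<close>, two vertices of an \<open>L\<close>-face can differ in four
coordinates, while those of a \<open>K\<close>-face differ in two; when \<open>k = 3\<close> both faces are congruent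
tetrahedra, but only the \<open>K\<close>-tetrahedron has a vertex of the half cube outside it at equal distance
from its four vertices.  For \<open>n = 4\<close> the half cube is a cross polytope, and the reflection that reverses the main
diagonal carries a face of type \<open>L\<close> to one of type \<open>K\<close>.

For the homology, let \<open>S\<close> have \<open>k\<close> elements.  The projection of the subcomplex \<open>C\<^bsub>n,k\<^esub>\<close> to the
coordinates in \<open>S\<close> avoids the origin (lemma \<open>C_nonzero_coordinate\<close>), because the only faces that meet
the fibre over the origin are those of type \<open>L\<close> whose free coordinates include \<open>S\<close>, and these have
been removed.  Pushing the image radially to the boundary of the \<open>k\<close>-dimensional half cube
spanned by \<open>L_set v S\<close> therefore retracts \<open>C\<^bsub>n,k\<^esub>\<close> onto a \<open>(k - 1)\<close>-sphere that it contains, so the homology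
in degree \<open>k - 1\<close> surjects onto that of the sphere.  The group acts because signed permutations
preserve the type and the dimension of a face, hence the subcomplex, and homology is functorial.
\<close>

section \<open>Sign vectors\<close>

text \<open>
The product of the coordinates is the parity of the number of negative ones in multiplicative form,
in which its behaviour under flips and permutations is immediate.
\<close>

definition sign_prod :: "real ^ 'n \<Rightarrow> real" where
  "sign_prod v = (\<Prod>i\<in>UNIV. v $ i)"

definition flip :: "'n set \<Rightarrow> real ^ 'n \<Rightarrow> real ^ 'n" where
  "flip A v = (\<chi> i. if i \<in> A then - v $ i else v $ i)"

lemma flip_nth [simp]: "flip A v $ i = (if i \<in> A then - v $ i else v $ i)"
  by (simp add: flip_def)

lemma prod_signs:
  fixes f :: "'n::finite \<Rightarrow> real"
  assumes "\<And>i. f i = 1 \<or> f i = -1"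
  shows "prod f UNIV = (-1) ^ card {i. f i = -1}"
proof -
  have "prod f UNIV = (\<Prod>i\<in>UNIV. if f i = -1 then -1 else 1)"
    using assms by (intro prod.cong) auto
  then show ?thesis
    by (simp add: prod.If_cases)
qed

lemma Psi_iff: "v \<in> Psi \<longleftrightarrow> (\<forall>i. v $ i = 1 \<or> v $ i = -1)"
  by (simp add: Psi_def)

lemma sign_prod_eq:
  assumes "v \<in> Psi"
  shows "sign_prod v = (-1) ^ card {i. v $ i < 0}"
proof -
  have "v $ i < 0 \<longleftrightarrow> v $ i = -1" for i
    using assms unfolding Psi_iff by (metis zero_less_one not_less_iff_gr_or_eq neg_less_0_iff_less)
  then show ?thesis
    using prod_signs[of "\<lambda>i. v $ i"] assms by (simp add: sign_prod_def Psi_iff)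
qed

lemma Psi_plus_iff: "v \<in> Psi_plus \<longleftrightarrow> v \<in> Psi \<and> sign_prod v = 1"
  by (auto simp: Psi_plus_def sign_prod_eq minus_one_power_iff split: if_splits)

lemma Psi_minus_iff: "v \<in> Psi_minus \<longleftrightarrow> v \<in> Psi \<and> sign_prod v = -1"
  by (auto simp: Psi_minus_def Psi_plus_iff sign_prod_eq minus_one_power_iff split: if_splits)

lemma flip_in_Psi [simp]: "flip A v \<in> Psi \<longleftrightarrow> v \<in> Psi"
proof -
  have "(if i \<in> A then - v $ i else v $ i) = 1 \<or> (if i \<in> A then - v $ i else v $ i) = -1
      \<longleftrightarrow> v $ i = 1 \<or> v $ i = -1" for i
    by auto
  then show ?thesis
    by (simp add: Psi_iff)
qed

lemma sign_prod_flip [simp]: "sign_prod (flip A v) = (-1) ^ card A * sign_prod v"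
proof -
  have "sign_prod (flip A v) = (\<Prod>i\<in>UNIV. (if i \<in> A then -1 else 1) * v $ i)"
    unfolding sign_prod_def by (intro prod.cong) auto
  then show ?thesis
    by (simp add: prod.distrib prod.If_cases sign_prod_def)
qed

lemma flip_flip: "flip A (flip B v) = flip (sym_diff A B) v"
  by (simp add: vec_eq_iff)

lemma flip_empty [simp]: "flip {} v = v"
  by (simp add: vec_eq_iff)

lemma Psi_eq_flip:
  assumes "v \<in> Psi" "w \<in> Psi"
  shows "w = flip {i. w $ i \<noteq> v $ i} v"
  using assms by (auto simp: vec_eq_iff Psi_iff) (metis minus_minus)

lemma Psi_nonzero: "v \<in> Psi \<Longrightarrow> v $ i \<noteq> 0"
  by (metis Psi_iff zero_neq_one neg_equal_0_iff_equal)

lemma Psi_square: "v \<in> Psi \<Longrightarrow> v $ i * v $ i = 1"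
  by (metis Psi_iff mult_1 mult_minus1 minus_minus)

lemma diff_flip:
  assumes "v \<in> Psi"
  shows "{i. flip A v $ i \<noteq> v $ i} = A"
  using Psi_nonzero[OF assms] by auto

lemma flip_inject:
  assumes "v \<in> Psi"
  shows "flip A v = flip B v \<longleftrightarrow> A = B"
  by (metis diff_flip[OF assms])

lemma one_in_Psi: "1 \<in> Psi"
  by (simp add: Psi_iff)

lemma finite_Psi [simp]: "finite (Psi :: (real ^ 'n) set)"
proof -
  have "(Psi :: (real ^ 'n) set) \<subseteq> (\<lambda>A. flip A 1) ` UNIV"
    using Psi_eq_flip[of "1 :: real ^ 'n"] by (blast intro: one_in_Psi)
  then show ?thesis
    by (rule finite_subset) simp
qed

lemma finite_Psi_plus [simp]: "finite (Psi_plus :: (real ^ 'n) set)"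
  by (rule finite_subset[OF _ finite_Psi]) (auto simp: Psi_plus_def)

text \<open>
A single flip changes the parity, so no condition on the parity remains.
\<close>

lemma K_set_eq:
  assumes "v \<in> Psi_minus"
  shows "K_set v S = (\<lambda>i. flip {i} v) ` S"
proof -
  have v: "v \<in> Psi" "sign_prod v = -1"
    using assms by (auto simp: Psi_minus_iff)
  show ?thesis
  proof (intro equalityI subsetI)
    fix w
    assume "w \<in> K_set v S"
    then obtain i where i: "i \<in> S" "{j. w $ j \<noteq> v $ j} = {i}" and w: "w \<in> Psi"
      unfolding K_set_def Psi_plus_iff by blast
    have "w = flip {i} v"
      using Psi_eq_flip[OF v(1) w] unfolding i(2) .
    then show "w \<in> (\<lambda>i. flip {i} v) ` S"
      using i(1) by (rule image_eqI)
  next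
    fix w
    assume "w \<in> (\<lambda>i. flip {i} v) ` S"
    then obtain i where "i \<in> S" "w = flip {i} v"
      by blast
    moreover have "flip {i} v \<in> Psi_plus"
      using v by (simp add: Psi_plus_iff)
    ultimately show "w \<in> K_set v S"
      unfolding K_set_def using diff_flip[OF v(1), of "{i}"] by blast
  qed
qed

text \<open>
A flip preserves evenness precisely when it affects an even number of coordinates.
\<close>

lemma L_set_eq:
  assumes "v \<in> Psi_plus"
  shows "L_set v S = {flip A v | A. A \<subseteq> S \<and> even (card A)}"
proof (intro equalityI subsetI)
  have v: "v \<in> Psi" "sign_prod v = 1"
    using assms by (auto simp: Psi_plus_iff)
  fix w
  {
    assume w: "w \<in> L_set v S"
    define A where "A = {i. w $ i \<noteq> v $ i}"
    have "w = flip A v"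
      unfolding A_def using w by (intro Psi_eq_flip v) (auto simp: L_set_def Psi_plus_iff)
    moreover from this have "even (card A)"
      using w v by (auto simp: L_set_def Psi_plus_iff minus_one_power_iff split: if_splits)
    moreover have "A \<subseteq> S"
      using w by (auto simp: A_def L_set_def)
    ultimately show "w \<in> {flip A v | A. A \<subseteq> S \<and> even (card A)}"
      by blast
  }
  assume "w \<in> {flip A v | A. A \<subseteq> S \<and> even (card A)}"
  then show "w \<in> L_set v S"
    using v by (auto simp: L_set_def Psi_plus_iff)
qed

lemma L_set_self: "v \<in> Psi_plus \<Longrightarrow> v \<in> L_set v S"
  by (simp add: L_set_def)

lemma K_set_subset: "K_set v S \<subseteq> Psi_plus"
  and L_set_subset: "L_set v S \<subseteq> Psi_plus"
  by (auto simp: K_set_def L_set_def)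

lemma flip_Psi_minus:
  assumes "v \<in> Psi_plus"
  shows "flip {i} v \<in> Psi_minus"
  using assms by (simp add: Psi_plus_iff Psi_minus_iff)

lemma flip_Psi_plus:
  assumes "v \<in> Psi_minus"
  shows "flip {i} v \<in> Psi_plus"
  using assms by (simp add: Psi_plus_iff Psi_minus_iff)

lemma flip2_Psi_plus:
  assumes "v \<in> Psi_plus" "i \<noteq> j"
  shows "flip {i, j} v \<in> Psi_plus"
  using assms by (simp add: Psi_plus_iff)

lemma one_Psi_plus: "1 \<in> Psi_plus"
  by (simp add: Psi_plus_iff Psi_iff sign_prod_def)

lemma L_set_UNIV: "L_set v UNIV = Psi_plus"
  by (auto simp: L_set_def)

text \<open>
Low-dimensional coincidences: vertices and edges arise from both types.  Counting them as type \<open>K\<close>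
leaves type \<open>L\<close> with three or more free coordinates, where dimension and cardinality agree.
\<close>

lemma L_set_small:
  assumes v: "v \<in> Psi_plus" and S: "card S \<le> 2"
  obtains u T where "u \<in> Psi_minus" "T \<noteq> {}" "L_set v S = K_set u T"
proof -
  consider "card S = 0" | "card S = 1" | "card S = 2"
    using S by linarith
  then show ?thesis
  proof cases
    case 1
    then have "L_set v S = K_set (flip {undefined} v) {undefined}"
      using v by (auto simp: L_set_eq K_set_eq flip_Psi_minus flip_flip)
    then show ?thesis
      using that flip_Psi_minus[OF v] by blast
  next
    case 2
    then obtain i where i: "S = {i}"
      using card_1_singletonE by blast
    have "A \<subseteq> {i} \<and> even (card A) \<longleftrightarrow> A = {}" for A
      by (auto simp: subset_singleton_iff)
    then have "L_set v S = K_set (flip {i} v) {i}"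
      using v by (auto simp: L_set_eq i K_set_eq flip_Psi_minus flip_flip)
    then show ?thesis
      using that flip_Psi_minus[OF v] by blast
  next
    case 3
    then obtain i j where ij: "S = {i, j}" "i \<noteq> j"
      by (meson card_2_iff)
    have "A \<subseteq> S \<and> even (card A) \<longleftrightarrow> A = {} \<or> A = {i, j}" for A
    proof
      assume A: "A \<subseteq> S \<and> even (card A)"
      then have "A = {} \<or> A = {i} \<or> A = {j} \<or> A = {i, j}"
        using ij by blast
      then show "A = {} \<or> A = {i, j}"
        using A ij by fastforce
    qed (use ij in auto)
    then have "L_set v S = {flip A v | A. A = {} \<or> A = {i, j}}"
      using v by (simp add: L_set_eq)
    then have "L_set v S = {v, flip {i, j} v}"
      by (auto intro: exI[of _ "{}"])
    also have "\<dots> = K_set (flip {i} v) {i, j}"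
    proof -
      have "sym_diff {j} {i} = {i, j}" "sym_diff {i} {i} = {}"
        using ij(2) by blast+
      then have "flip {j} (flip {i} v) = flip {i, j} v" "flip {i} (flip {i} v) = v"
        unfolding flip_flip by (metis flip_empty)+
      from this show ?thesis
        unfolding K_set_eq[OF flip_Psi_minus[OF v]] by simp
    qed
    finally show ?thesis
      by (intro that[OF flip_Psi_minus[OF v]]) auto
  qed
qed

section \<open>Faces of the half cube\<close>

lemma face_of_convex_hull_vertices:
  fixes V :: "'a::euclidean_space set"
  assumes V: "finite V" and F: "F face_of convex hull V"
  shows "F = convex hull (V \<inter> F)"
proof
  obtain T where T: "T \<subseteq> V" "F = convex hull T"
    using face_of_convex_hull_subset[OF finite_imp_compact[OF V] F] .
  then show "F \<subseteq> convex hull (V \<inter> F)"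
    by (metis Int_subset_iff hull_mono hull_subset)
  show "convex hull (V \<inter> F) \<subseteq> F"
    by (intro hull_minimal) (auto intro: face_of_imp_convex[OF F])
qed

text \<open>
This is how the candidate faces are recognised as faces: it suffices to exhibit a functional.
\<close>

lemma maximizers_face_of_convex_hull:
  fixes V :: "'a::euclidean_space set"
  assumes V: "finite V" and le: "\<And>x. x \<in> V \<Longrightarrow> a \<bullet> x \<le> b"
  shows "convex hull {x \<in> V. a \<bullet> x = b} face_of convex hull V"
proof -
  have "convex hull V \<subseteq> {x. a \<bullet> x \<le> b}"
    using le by (intro hull_minimal) (auto simp: convex_halfspace_le)
  then have F: "(convex hull V \<inter> {x. a \<bullet> x = b}) face_of convex hull V"
    by (intro face_of_Int_supporting_hyperplane_le) auto
  have "V \<inter> (convex hull V \<inter> {x. a \<bullet> x = b}) = {x \<in> V. a \<bullet> x = b}"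
    by (auto intro: hull_inc)
  with F face_of_convex_hull_vertices[OF V F] show ?thesis
    by simp
qed

lemma polytope_half_cube: "polytope (half_cube :: (real ^ 'n) set)"
  unfolding half_cube_def polytope_def using finite_Psi_plus by blast

lemma polyhedron_half_cube: "polyhedron (half_cube :: (real ^ 'n) set)"
  by (rule polytope_imp_polyhedron[OF polytope_half_cube])

lemma Psi_inner_self: 
  fixes v :: "real ^ 'n"
  assumes "v \<in> Psi" 
  shows "v \<bullet> v = CARD('n)"
  using assms by (simp add: inner_vec_def Psi_square)

text \<open>
Sign vectors lie on a sphere around the origin, so each is strictly separated from all the others by
the functional given by its own inner product.
\<close>

lemma Psi_inter_convex_hull:
  fixes A :: "(real ^ 'n) set"
  assumes "A \<subseteq> Psi"
  shows "Psi \<inter> convex hull A = A"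
proof
  show "Psi \<inter> convex hull A \<subseteq> A"
  proof
    fix v
    assume v: "v \<in> Psi \<inter> convex hull A"
    show "v \<in> A"
    proof (rule ccontr)
      assume "v \<notin> A"
      have "v \<bullet> x < v \<bullet> v" if "x \<in> A" for x
      proof -
        have "0 < (x - v) \<bullet> (x - v)"
          using that \<open>v \<notin> A\<close> by auto
        also have "\<dots> = x \<bullet> x + v \<bullet> v - 2 * (v \<bullet> x)"
          by (simp add: inner_diff inner_commute)
        finally show ?thesis
          using that v assms by (simp add: Psi_inner_self subset_iff)
      qed
      then have "convex hull A \<subseteq> {x. v \<bullet> x < v \<bullet> v}"
        by (intro hull_minimal) (auto simp: convex_halfspace_lt)
      then show False
        using v by blast
    qed
  qed
qed (use assms in \<open>auto intro: hull_inc\<close>)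

lemma Psi_plus_inter_convex_hull:
  assumes "A \<subseteq> Psi_plus"
  shows "Psi_plus \<inter> convex hull A = A"
  using Psi_inter_convex_hull[of A] assms hull_subset[of A convex]
  by (auto simp: Psi_plus_def)

text \<open>
Equations between faces thereby reduce to equations between their vertex sets.
\<close>

lemma convex_hull_inject:
  assumes "A \<subseteq> Psi_plus" "B \<subseteq> Psi_plus" 
  shows "convex hull A = convex hull B \<longleftrightarrow> A = B"
  by (metis Psi_plus_inter_convex_hull assms)

lemma inner_flip:
  fixes a v :: "real ^ 'n"
  shows "a \<bullet> flip A v = a \<bullet> v - 2 * (\<Sum>i\<in>A. a $ i * v $ i)"
proof -
  have "a \<bullet> flip A v = (\<Sum>i\<in>UNIV. a $ i * v $ i - 2 * (if i \<in> A then a $ i * v $ i else 0))"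
    unfolding inner_vec_def by (intro sum.cong) auto
  then show ?thesis
    by (simp add: inner_vec_def sum_subtractf sum.If_cases flip: sum_distrib_left)
qed

text \<open>
The supporting functional is \<open>v\<close> with the weight of the coordinates outside \<open>S\<close> doubled: reaching even
parity from \<open>v\<close> costs least by a single flip inside \<open>S\<close>.
\<close>

lemma face_K_set:
  fixes v :: "real ^ 'n"
  assumes v: "v \<in> Psi_minus"
  shows "convex hull K_set v S face_of half_cube"
proof (cases "S = {}")
  case True
  then show ?thesis
    by (simp add: K_set_def)
next
  case False
  have v': "v \<in> Psi" "sign_prod v = -1"
    using v by (auto simp: Psi_minus_iff)
  define a :: "real ^ 'n" where "a = (\<chi> i. (if i \<in> S then 1 else 2) * v $ i)"
  define b where "b = a \<bullet> v - 2"
  have eq: "a \<bullet> flip A v = a \<bullet> v - 2 * (\<Sum>i\<in>A. if i \<in> S then 1 else 2)" for A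
    by (simp add: inner_flip a_def Psi_square[OF v'(1)] mult.assoc cong: if_cong)
  have gt: "(\<Sum>i\<in>A. if i \<in> S then 1 else 2 :: real) > 1" 
    if A: "A \<noteq> {}" "\<nexists>i. i \<in> S \<and> A = {i}" for A :: "'n set"
  proof -
    obtain i where i: "i \<in> A"
      using A by blast
    have "(\<Sum>i\<in>A. if i \<in> S then 1 else 2 :: real) = (if i \<in> S then 1 else 2) + (\<Sum>i\<in>A - {i}. if i \<in> S then 1 else 2 :: real)"
      using i by (simp add: sum.remove)
    moreover have "(\<Sum>i\<in>A - {i}. if i \<in> S then 1 else 2 :: real) \<ge> 0"
      by (intro sum_nonneg) auto
    moreover have "(\<Sum>i\<in>A - {i}. if i \<in> S then 1 else 2 :: real) > 0" if "i \<in> S"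
      using that A i by (intro sum_pos) auto
    ultimately show ?thesis
      by (auto split: if_splits)
  qed
  have max: "a \<bullet> x \<le> b \<and> (a \<bullet> x = b \<longleftrightarrow> x \<in> K_set v S)" if x: "x \<in> Psi_plus" for x
  proof -
    define A where "A = {i. x $ i \<noteq> v $ i}"
    have xA: "x = flip A v"
      unfolding A_def using x v' by (intro Psi_eq_flip) (auto simp: Psi_plus_iff)
    have "A \<noteq> {}"
      using x v' xA by (auto simp: Psi_plus_iff)
    have K: "x \<in> K_set v S \<longleftrightarrow> (\<exists>i. i \<in> S \<and> A = {i})"
      using v by (auto simp: K_set_eq xA flip_inject[OF v'(1)])
    show ?thesis
    proof (cases "\<exists>i. i \<in> S \<and> A = {i}")
      case True
      then show ?thesis
        using K eq[of A] by (auto simp: b_def xA)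
    next
      case False
      then show ?thesis
        using K eq[of A] gt[OF \<open>A \<noteq> {}\<close> False] by (auto simp: b_def xA)
    qed
  qed
  then have "K_set v S = {x \<in> Psi_plus. a \<bullet> x = b}"
    using K_set_subset by blast
  then show ?thesis
    unfolding half_cube_def using max by (simp add: maximizers_face_of_convex_hull)
qed

text \<open>
The supporting functional is \<open>v\<close> with the coordinates in \<open>S\<close> set to zero, so that deviating from \<open>v\<close>
is penalised exactly outside \<open>S\<close>.
\<close>

lemma face_L_set:
  fixes v :: "real ^ 'n"
  assumes v: "v \<in> Psi_plus"
  shows "convex hull L_set v S face_of half_cube"
proof -
  have v': "v \<in> Psi" "sign_prod v = 1"
    using v by (auto simp: Psi_plus_iff)
  define a :: "real ^ 'n" where "a = (\<chi> i. if i \<in> S then 0 else v $ i)"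
  define b where "b = a \<bullet> v"
  have max: "a \<bullet> x \<le> b \<and> (a \<bullet> x = b \<longleftrightarrow> x \<in> L_set v S)" if x: "x \<in> Psi_plus" for x
  proof -
    define A where "A = {i. x $ i \<noteq> v $ i}"
    have xA: "x = flip A v"
      unfolding A_def using x v' by (intro Psi_eq_flip) (auto simp: Psi_plus_iff)
    have "even (card A)"
      using x v' xA by (auto simp: Psi_plus_iff minus_one_power_iff split: if_splits)
    then have K: "x \<in> L_set v S \<longleftrightarrow> A \<subseteq> S"
      using v by (auto simp: L_set_eq xA flip_inject[OF v'(1)])
    have "(\<Sum>i\<in>A. a $ i * v $ i) = card (A - S)"
      by (simp add: a_def if_distrib[of "\<lambda>x. x * _"] Psi_square[OF v'(1)] sum.If_cases Diff_eq cong: if_cong)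
    then show ?thesis
      unfolding K by (auto simp: b_def xA inner_flip)
  qed
  then have "L_set v S = {x \<in> Psi_plus. a \<bullet> x = b}"
    using L_set_subset by blast
  then show ?thesis
    unfolding half_cube_def using max by (simp add: maximizers_face_of_convex_hull)
qed

text \<open>
The classification of the maximisers of a functional over the even sign vectors; see the introduction
for the three cases.
\<close>

lemma Psi_plus_maximizers:
  fixes a :: "real ^ 'n"
  assumes le: "\<And>x. x \<in> Psi_plus \<Longrightarrow> a \<bullet> x \<le> b"
    and w: "w \<in> Psi_plus" "a \<bullet> w = b"
  shows "(\<exists>v\<in>Psi_minus. \<exists>S. S \<noteq> {} \<and> {x \<in> Psi_plus. a \<bullet> x = b} = K_set v S)
       \<or> (\<exists>v\<in>Psi_plus. \<exists>S. {x \<in> Psi_plus. a \<bullet> x = b} = L_set v S)"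
proof (cases "\<exists>z. a $ z = 0")
  case True
  then obtain z where z: "a $ z = 0"
    by blast
  \<comment> \<open>A coordinate z with weight zero can be flipped for free to repair the parity.\<close>
  have agree: "a $ i * x $ i > 0" if x: "x \<in> Psi_plus" "a \<bullet> x = b" and i: "a $ i \<noteq> 0" for x i
  proof -
    have "i \<noteq> z"
      using i z by auto
    then have "a \<bullet> flip {i, z} x \<le> b"
      by (intro le flip2_Psi_plus x) auto
    then have "a $ i * x $ i \<ge> 0"
      using \<open>i \<noteq> z\<close> x z by (simp add: inner_flip)
    moreover have "x $ i \<noteq> 0"
      using x by (simp add: Psi_nonzero Psi_plus_iff)
    ultimately show ?thesis
      using i by (simp add: less_le)
  qed
  have "{x \<in> Psi_plus. a \<bullet> x = b} = L_set w {i. a $ i = 0}"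
  proof (intro equalityI subsetI)
    fix x
    assume "x \<in> {x \<in> Psi_plus. a \<bullet> x = b}"
    then have x: "x \<in> Psi_plus" "a \<bullet> x = b"
      by auto
    have "x $ i = w $ i" if "a $ i \<noteq> 0" for i
    proof -
      have "x $ i = 1 \<or> x $ i = -1" "w $ i = 1 \<or> w $ i = -1"
        using x w by (auto simp: Psi_plus_iff Psi_iff)
      with agree[OF x that] agree[OF w that] show ?thesis
        by auto
    qed
    then show "x \<in> L_set w {i. a $ i = 0}"
      using x by (auto simp: L_set_def)
  next
    fix x
    assume x: "x \<in> L_set w {i. a $ i = 0}"
    have "a $ i * x $ i = a $ i * w $ i" for i
      using x by (cases "a $ i = 0") (auto simp: L_set_def)
    then have "a \<bullet> x = a \<bullet> w"
      unfolding inner_vec_def by (intro sum.cong) (simp_all)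
    then show "x \<in> {x \<in> Psi_plus. a \<bullet> x = b}"
      using x w by (auto simp: L_set_def)
  qed
  then show ?thesis
    using w by blast
next
  case False
  define s :: "real ^ 'n" where "s = (\<chi> i. sgn (a $ i))"
  have s: "s \<in> Psi"
    using False by (auto simp: s_def Psi_iff sgn_if)
  have pos: "a $ i * s $ i > 0" for i
    using False by (auto simp: s_def sgn_if not_less less_le)
  have flip_gt: "a \<bullet> flip A s < a \<bullet> flip B s" if BA: "B \<subset> A" for A B
  proof -
    have "(\<Sum>i\<in>B. a $ i * s $ i) < (\<Sum>i\<in>A. a $ i * s $ i)"
    proof -
      obtain i where "i \<in> A - B"
        using BA by blast
      then show ?thesis
        using BA by (intro sum_strict_mono2[of A B i]) (auto intro: less_imp_le[OF pos] pos)
    qed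
    then show ?thesis
      by (simp add: inner_flip)
  qed
  show ?thesis
  proof (cases "s \<in> Psi_plus")
    case True
    have "x = s" if x: "x \<in> Psi_plus" "a \<bullet> x = b" for x
    proof (rule ccontr)
      assume "x \<noteq> s"
      have xA: "x = flip {i. x $ i \<noteq> s $ i} s"
        using x by (intro Psi_eq_flip s) (auto simp: Psi_plus_iff)
      with \<open>x \<noteq> s\<close> have "{} \<subset> {i. x $ i \<noteq> s $ i}"
        by auto
      from flip_gt[OF this] have "a \<bullet> x < a \<bullet> s"
        using xA by simp
      with le[OF True] x show False
        by simp
    qed
    then have "{x \<in> Psi_plus. a \<bullet> x = b} = L_set s {}"
      using True w by (auto simp: L_set_eq)
    then show ?thesis
      using True by blast
  next
    case neg: False
    then have sm: "s \<in> Psi_minus"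
      using s by (simp add: Psi_minus_def)
    define S where "S = {i. a \<bullet> flip {i} s = b}"
    have "x \<in> K_set s S" if x: "x \<in> Psi_plus" "a \<bullet> x = b" for x
    proof -
      define A where "A = {i. x $ i \<noteq> s $ i}"
      have xA: "x = flip A s"
        unfolding A_def using x by (intro Psi_eq_flip s) (auto simp: Psi_plus_iff)
      with x neg have "A \<noteq> {}"
        by auto
      then obtain i where i: "i \<in> A"
        by blast
      have "\<not> {i} \<subset> A"
      proof
        assume "{i} \<subset> A"
        from flip_gt[OF this] le[OF flip_Psi_plus[OF sm, of i]] x xA show False
          by simp
      qed
      with i have "A = {i}"
        by auto
      with x xA have "i \<in> S" "x = flip {i} s"
        by (auto simp: S_def)
      then show ?thesis
        using sm by (auto simp: K_set_eq)
    qed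
    moreover have "a \<bullet> x = b" if "x \<in> K_set s S" for x
      using that sm by (auto simp: K_set_eq S_def)
    ultimately have "{x \<in> Psi_plus. a \<bullet> x = b} = K_set s S"
      using K_set_subset by blast
    moreover from this have "S \<noteq> {}"
      using w by (auto simp: K_set_def)
    ultimately show ?thesis
      using sm by blast
  qed
qed

lemma half_cube_faces:
  assumes F: "F face_of half_cube" and ne: "F \<noteq> {}"
  shows "(\<exists>v\<in>Psi_minus. \<exists>S. S \<noteq> {} \<and> F = convex hull K_set v S)
       \<or> (\<exists>v\<in>Psi_plus. \<exists>S. card S \<ge> 3 \<and> F = convex hull L_set v S)"
proof -
  have "F exposed_face_of half_cube"
    by (simp add: F exposed_face_of_polyhedron[OF polyhedron_half_cube])
  then obtain a b where ab: "half_cube \<subseteq> {x. a \<bullet> x \<le> b}" "F = half_cube \<inter> {x. a \<bullet> x = b}"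
    by (auto simp: exposed_face_of_def)
  have inc: "x \<in> half_cube" if "x \<in> Psi_plus" for x
    using that by (simp add: half_cube_def hull_inc)
  have hull: "F = convex hull (Psi_plus \<inter> F)"
    using face_of_convex_hull_vertices[OF finite_Psi_plus] F unfolding half_cube_def .
  have VF: "Psi_plus \<inter> F = {x \<in> Psi_plus. a \<bullet> x = b}"
    using inc ab by auto
  have "Psi_plus \<inter> F \<noteq> {}"
    using hull ne by (metis convex_hull_empty)
  then obtain w where "w \<in> Psi_plus" "a \<bullet> w = b"
    using VF by blast
  moreover have "a \<bullet> x \<le> b" if "x \<in> Psi_plus" for x
    using inc[OF that] ab by blast
  ultimately have "(\<exists>v\<in>Psi_minus. \<exists>S. S \<noteq> {} \<and> Psi_plus \<inter> F = K_set v S)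
      \<or> (\<exists>v\<in>Psi_plus. \<exists>S. Psi_plus \<inter> F = L_set v S)"
    unfolding VF by (intro Psi_plus_maximizers) auto
  then consider v S where "v \<in> Psi_minus" "S \<noteq> {}" "Psi_plus \<inter> F = K_set v S"
    | v S where "v \<in> Psi_plus" "Psi_plus \<inter> F = L_set v S"
    by blast
  then show ?thesis
  proof cases
    case 1
    then show ?thesis
      using hull by metis
  next
    case 2
    show ?thesis
    proof (cases "card S \<ge> 3")
      case True
      then show ?thesis
        using hull 2 by metis
    next
      case False
      then have "card S \<le> 2"
        by simp
      from L_set_small[OF 2(1) this] show ?thesis
        using hull 2(2) by metis
    qed
  qed
qed

section \<open>Dimensions of the faces\<close>

text \<open>
Seen from \<open>v\<close>, the vertices are nonzero multiples of different unit vectors, so they span a simplex.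
\<close>

lemma aff_dim_K_set:
  fixes v :: "real ^ 'n"
  assumes v: "v \<in> Psi_minus"
  shows "aff_dim (convex hull K_set v S) = int (card S) - 1"
proof -
  have nz: "v $ i \<noteq> 0" for i
    using v by (simp add: Psi_nonzero Psi_minus_iff)
  define f :: "'n \<Rightarrow> real ^ 'n" where "f i = axis i (- 2 * v $ i)" for i
  have f: "flip {i} v = v + f i" for i
    by (simp add: f_def vec_eq_iff axis_def)
  have K: "K_set v S = (+) v ` f ` S"
    using v by (auto simp: K_set_eq f)
  have inj: "inj_on f S"
    using nz by (auto simp: inj_on_def f_def axis_eq_axis)
  have "independent (f ` S)"
  proof (rule pairwise_orthogonal_independent)
    show "pairwise orthogonal (f ` S)"
      by (auto simp: pairwise_def orthogonal_def f_def inner_axis_axis)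
    show "0 \<notin> f ` S"
      using nz by (auto simp: f_def axis_eq_0_iff)
  qed
  then have "\<not> affine_dependent (f ` S)"
    using affine_dependent_imp_dependent by blast
  from aff_dim_affine_independent[OF this] have "aff_dim (f ` S) = int (card S) - 1"
    by (simp add: card_image inj)
  then show ?thesis
    by (simp add: K aff_dim_convex_hull aff_dim_translation_eq)
qed

definition coord_space :: "'n set \<Rightarrow> (real ^ 'n) set" where
  "coord_space S = {x. \<forall>i. i \<notin> S \<longrightarrow> x $ i = 0}"

lemma subspace_coord_space: "subspace (coord_space S)"
  by (auto simp: subspace_def coord_space_def)

lemma dim_coord_space: "dim (coord_space S) = card S"
  unfolding coord_space_def by (rule dim_substandard_cart[where 'a = real, unfolded dim_vec_eq])

text \<open>
Flipping a pair gives the direction \<open>e i + e j\<close>, and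
\<open>2 * e i = (e i + e j) + (e i + e l) - (e j + e l)\<close> recovers a single axis.  This takes three free
coordinates.
\<close>

lemma span_L_set:
  assumes v: "v \<in> Psi_plus" and S: "card S \<ge> 3"
  shows "span ((\<lambda>x. x - v) ` L_set v S) = coord_space S" (is "span ?D = _")
proof
  have "?D \<subseteq> coord_space S"
    by (auto simp: coord_space_def L_set_def)
  then show "span ?D \<subseteq> coord_space S"
    using span_minimal subspace_coord_space by blast
  have nz: "v $ i \<noteq> 0" for i
    using v by (simp add: Psi_nonzero Psi_plus_iff)
  define e where "e i = axis i (v $ i)" for i
  have pair: "e i + e j \<in> span ?D" if "i \<in> S" "j \<in> S" "i \<noteq> j" for i j
  proof -
    have "flip {i, j} v - v \<in> ?D"
      using that v by (intro imageI) (auto simp: L_set_def flip2_Psi_plus)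
    then have "(- 1 / 2) *\<^sub>R (flip {i, j} v - v) \<in> span ?D"
      by (intro span_scale span_base)
    also have "(- 1 / 2) *\<^sub>R (flip {i, j} v - v) = e i + e j"
      using that by (auto simp: vec_eq_iff e_def axis_def)
    finally show ?thesis .
  qed
  have axis: "axis i 1 \<in> span ?D" if i: "i \<in> S" for i
  proof -
    have "card (S - {i}) \<ge> 2"
      using S i by (simp add: card_Diff_singleton)
    then obtain T where T: "T \<subseteq> S - {i}" "card T = 2"
      by (meson obtain_subset_with_card_n)
    then obtain j l where jl: "j \<in> S" "l \<in> S" "j \<noteq> i" "l \<noteq> i" "j \<noteq> l"
      by (auto simp: card_2_iff)
    have "(1 / (2 * v $ i)) *\<^sub>R ((e i + e j) + (e i + e l) - (e j + e l)) \<in> span ?D"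
      using jl i by (intro span_scale span_diff span_add pair) auto
    also have "(1 / (2 * v $ i)) *\<^sub>R ((e i + e j) + (e i + e l) - (e j + e l)) = axis i 1"
      using nz by (simp add: e_def vec_eq_iff axis_def)
    finally show ?thesis .
  qed
  show "coord_space S \<subseteq> span ?D"
  proof
    fix x
    assume x: "x \<in> coord_space S"
    have "x = (\<Sum>i\<in>UNIV. x $ i *\<^sub>R axis i 1)"
      using basis_expansion[of x] by (simp add: scalar_mult_eq_scaleR)
    also have "\<dots> \<in> span ?D"
    proof (intro span_sum)
      fix i
      show "x $ i *\<^sub>R axis i 1 \<in> span ?D"
        using x axis[of i] by (cases "i \<in> S") (auto simp: coord_space_def span_scale span_zero)
    qed
    finally show "x \<in> span ?D" .
  qed
qed

lemma affine_hull_L_set: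
  assumes v: "v \<in> Psi_plus" and S: "card S \<ge> 3"
  shows "affine hull (convex hull L_set v S) = {x. \<forall>i. i \<notin> S \<longrightarrow> x $ i = v $ i}"
proof -
  have "affine hull L_set v S = (+) v ` span ((\<lambda>x. x - v) ` L_set v S)"
    using affine_hull_span_gen[of v "L_set v S"] L_set_self[OF v, of S]
    by (simp add: hull_inc)
  also have "\<dots> = {x. \<forall>i. i \<notin> S \<longrightarrow> x $ i = v $ i}"
  proof (intro equalityI subsetI)
    fix x
    assume "x \<in> {x. \<forall>i. i \<notin> S \<longrightarrow> x $ i = v $ i}"
    then have "x - v \<in> coord_space S"
      by (simp add: coord_space_def)
    then show "x \<in> (+) v ` span ((\<lambda>x. x - v) ` L_set v S)"
      by (simp add: span_L_set[OF v S] image_iff) (metis add.commute diff_add_cancel)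
  qed (auto simp: span_L_set[OF v S] coord_space_def)
  finally show ?thesis
    by simp
qed

lemma aff_dim_L_set:
  assumes v: "v \<in> Psi_plus" and S: "card S \<ge> 3"
  shows "aff_dim (convex hull L_set v S) = int (card S)"
proof -
  have "aff_dim (L_set v S) = int (dim ((\<lambda>x. x - v) ` L_set v S))"
    using aff_dim_eq_dim_subtract[of v "L_set v S"] L_set_self[OF v, of S] by (simp add: hull_inc)
  also have "\<dots> = int (card S)"
    by (metis dim_coord_space dim_span span_L_set[OF v S])
  finally show ?thesis
    by (simp add: aff_dim_convex_hull)
qed

lemma aff_dim_half_cube:
  assumes "CARD('n) \<ge> 3"
  shows "aff_dim (half_cube :: (real ^ 'n) set) = int CARD('n)"
  using aff_dim_L_set[OF one_Psi_plus, of "UNIV :: 'n set"] assms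
  by (simp add: L_set_UNIV half_cube_def)

text \<open>
The guard is needed because for \<open>k = 1\<close> and \<open>k = 2\<close> a set \<open>L_set v S\<close> with \<open>card S = k\<close> spans a face of
dimension \<open>k - 1\<close> only.
\<close>

lemma k_faces_eq:
  "(k_faces k :: (real ^ 'n) set set) = K_faces k \<union> (if k \<ge> 3 then L_faces k else {})"
proof (intro equalityI subsetI)
  fix F :: "(real ^ 'n) set"
  assume "F \<in> k_faces k"
  then have F: "F face_of half_cube" "aff_dim F = int k"
    by (auto simp: k_faces_def)
  then have "F \<noteq> {}"
    by auto
  from half_cube_faces[OF F(1) this]
  show "F \<in> K_faces k \<union> (if k \<ge> 3 then L_faces k else {})"
  proof (elim disjE bexE exE conjE)
    fix v :: "real ^ 'n" and S
    assume v: "v \<in> Psi_minus" and FK: "F = convex hull K_set v S"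
    have "card S = k + 1"
      using F(2) aff_dim_K_set[OF v, of S] by (simp add: FK)
    then show ?thesis
      using v FK by (auto simp: K_faces_def)
  next
    fix v :: "real ^ 'n" and S
    assume v: "v \<in> Psi_plus" and S: "card S \<ge> 3" and FL: "F = convex hull L_set v S"
    have "card S = k"
      using F(2) aff_dim_L_set[OF v S] by (simp add: FL)
    then show ?thesis
      using v FL S by (auto simp: L_faces_def)
  qed
next
  fix F :: "(real ^ 'n) set"
  assume "F \<in> K_faces k \<union> (if k \<ge> 3 then L_faces k else {})"
  then show "F \<in> k_faces k"
    by (auto simp: k_faces_def K_faces_def L_faces_def face_K_set face_L_set aff_dim_K_set
        aff_dim_L_set split: if_splits)
qed

text \<open>
Descending from a point of the relative boundary to a proper face lowers the dimension, so the descent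
ends at a face with the point in its relative interior.
\<close>

lemma face_rel_interior_cover:
  fixes S :: "'a::euclidean_space set"
  assumes S: "polyhedron S" and x: "x \<in> S"
  obtains F where "F face_of S" "x \<in> rel_interior F"
proof -
  have "\<exists>F. F face_of S \<and> x \<in> rel_interior F"
    using S x
  proof (induction "nat (aff_dim S + 1)" arbitrary: S rule: less_induct)
    case less
    show ?case
    proof (cases "x \<in> rel_interior S")
      case True
      then show ?thesis
        using face_of_refl[OF polyhedron_imp_convex[OF less.prems(1)]] by blast
    next
      case False
      then have "x \<in> rel_frontier S"
        using less.prems by (simp add: rel_frontier_def closure_subset[THEN subsetD])
      then obtain F where F: "F face_of S" "F \<noteq> S" "x \<in> F"
        using less.prems(1) by (auto simp: rel_frontier_of_polyhedron_alt)
      have "aff_dim F < aff_dim S"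
        using F less.prems by (intro face_of_aff_dim_lt polyhedron_imp_convex)
      moreover have "aff_dim F \<ge> -1"
        by (rule aff_dim_geq)
      ultimately have "nat (aff_dim F + 1) < nat (aff_dim S + 1)"
        by linarith
      from less.hyps[OF this face_of_polyhedron_polyhedron[OF less.prems(1) F(1)] F(3)]
      show ?thesis
        using F(1) face_of_trans by blast
    qed
  qed
  then show ?thesis
    using that by blast
qed

section \<open>The symmetry groups\<close>

lemma linear_signed_perm: "linear (signed_perm s p)"
  by (rule linearI) (auto simp: signed_perm_def vec_eq_iff algebra_simps)

lemma signed_perm_compose:
  "signed_perm s p \<circ> signed_perm t q = signed_perm (\<lambda>i. s i * t (p i)) (q \<circ> p)"
  by (auto simp: signed_perm_def fun_eq_iff vec_eq_iff)

lemma signed_perm_id: "signed_perm (\<lambda>i. 1) id = id"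
  by (simp add: signed_perm_def fun_eq_iff)

lemma bij_prod_reindex:
  fixes f :: "'n::finite \<Rightarrow> real"
  assumes "bij p"
  shows "(\<Prod>i\<in>UNIV. f (p i)) = prod f UNIV"
  using prod.reindex_bij_betw[OF assms] .

lemma sign_prod_signed_perm:
  assumes "bij p"
  shows "sign_prod (signed_perm s p v) = prod s UNIV * sign_prod v"
  using bij_prod_reindex[OF assms, of "\<lambda>i. v $ i"]
  by (simp add: sign_prod_def signed_perm_def prod.distrib)

lemma signed_perm_in_Psi:
  assumes "\<And>i. s i = 1 \<or> s i = -1" and v: "v \<in> Psi"
  shows "signed_perm s p v \<in> Psi"
  unfolding Psi_iff
proof
  fix i
  have "s i = 1 \<or> s i = -1" "v $ p i = 1 \<or> v $ p i = -1"
    using assms by (auto simp: Psi_iff)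
  then show "signed_perm s p v $ i = 1 \<or> signed_perm s p v $ i = -1"
    by (auto simp: signed_perm_def)
qed

lemma signed_perm_flip:
  "signed_perm s p (flip A v) = flip (p -` A) (signed_perm s p v)"
  by (simp add: signed_perm_def vec_eq_iff)

lemma WD_carrier:
  "(carrier WD :: (real ^ 'n \<Rightarrow> real ^ 'n) set) = {signed_perm s p | s p.
     bij p \<and> (\<forall>i. s i = 1 \<or> s i = -1) \<and> prod s UNIV = 1}"
proof -
  have "even (card {i. s i = -1}) \<longleftrightarrow> prod s (UNIV :: 'n::finite set) = 1"
    if "\<forall>i. s i = 1 \<or> s i = -1" for s :: "'n::finite \<Rightarrow> real"
    using that by (simp add: prod_signs minus_one_power_iff)
  then show ?thesis
    unfolding WD_def by auto
qed

lemma WD_E: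
  assumes "g \<in> carrier WD"
  obtains s p where "g = signed_perm s p" "bij p"
    "\<And>i. s i = 1 \<or> s i = -1" "prod s UNIV = 1"
  using assms unfolding WD_carrier by auto

lemma carrier_half_cube_group:
  "carrier half_cube_group = {g. orthogonal_transformation g \<and> g ` half_cube = half_cube}"
  by (simp add: half_cube_group_def orthogonal_group_def)

lemma orthogonal_transformation_signed_perm:
  fixes s :: "'n::finite \<Rightarrow> real"
  assumes "bij p" and s: "\<And>i. s i = 1 \<or> s i = -1"
  shows "orthogonal_transformation (signed_perm s p)"
proof -
  have ss: "s i * s i = 1" for i
    using s[of i] by auto
  have "signed_perm s p v \<bullet> signed_perm s p w = v \<bullet> w" for v w
  proof -
    have "signed_perm s p v \<bullet> signed_perm s p w = (\<Sum>i\<in>UNIV. (s i * s i) * (v $ p i * w $ p i))"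
      unfolding inner_vec_def signed_perm_def by (simp add: mult_ac)
    also have "\<dots> = (\<Sum>i\<in>UNIV. v $ p i * w $ p i)"
      by (simp add: ss)
    also have "\<dots> = v \<bullet> w"
      unfolding inner_vec_def using sum.reindex_bij_betw[OF assms(1), of "\<lambda>i. v $ i * w $ i"] by simp
    finally show ?thesis .
  qed
  then show ?thesis
    by (simp add: orthogonal_transformation_def linear_signed_perm)
qed

lemma orthogonal_transformation_identity: "orthogonal_transformation id"
  by (simp add: orthogonal_transformation_def linear_id)

lemma group_orthogonal_group: "group orthogonal_group"
proof (rule groupI)
  fix g :: "real ^ 'n \<Rightarrow> real ^ 'n"
  assume "g \<in> carrier orthogonal_group"
  then have g: "orthogonal_transformation g"
    by (simp add: orthogonal_group_def)
  then have "inv_into UNIV g \<circ> g = id"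
    by (simp add: orthogonal_transformation_inj)
  with g show "\<exists>h\<in>carrier orthogonal_group. h \<otimes>\<^bsub>orthogonal_group\<^esub> g = \<one>\<^bsub>orthogonal_group\<^esub>"
    by (auto simp: orthogonal_group_def intro: orthogonal_transformation_inv)
qed (auto simp: orthogonal_group_def orthogonal_transformation_compose o_assoc
      orthogonal_transformation_identity)

lemma subgroup_orthogonal_groupI:
  assumes orth: "\<And>g. g \<in> H \<Longrightarrow> orthogonal_transformation g"
    and id: "id \<in> H"
    and comp: "\<And>g h. \<lbrakk>g \<in> H; h \<in> H\<rbrakk> \<Longrightarrow> g \<circ> h \<in> H"
    and inv: "\<And>g. g \<in> H \<Longrightarrow> \<exists>h\<in>H. h \<circ> g = id"
  shows "subgroup H orthogonal_group"
proof (rule group.subgroupI[OF group_orthogonal_group])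
  fix g
  assume g: "g \<in> H"
  obtain h where h: "h \<in> H" "h \<circ> g = id"
    using inv[OF g] by blast
  have "inv\<^bsub>orthogonal_group\<^esub> g = h"
    using h g orth by (intro group.inv_equality[OF group_orthogonal_group])
      (auto simp: orthogonal_group_def)
  with h show "inv\<^bsub>orthogonal_group\<^esub> g \<in> H"
    by simp
qed (use assms in \<open>auto simp: orthogonal_group_def\<close>)

lemma WD_inverse:
  assumes "g \<in> carrier (WD :: (real ^ 'n \<Rightarrow> real ^ 'n) monoid)"
  obtains h where "h \<in> carrier WD" "h \<circ> g = id" "g \<circ> h = id"
proof -
  obtain s :: "'n \<Rightarrow> real" and p where g: "g = signed_perm s p" and p: "bij p"
    and s: "\<And>i. s i = 1 \<or> s i = -1" and s1: "prod s UNIV = 1"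
    using WD_E[OF assms] by metis
  define h where "h = signed_perm (\<lambda>i. s (inv_into UNIV p i)) (inv_into UNIV p)"
  have "(\<Prod>i\<in>UNIV. s (inv_into UNIV p i)) = 1"
    using bij_prod_reindex[of "inv_into UNIV p" s] p s1 by (simp add: bij_imp_bij_inv)
  then have "h \<in> carrier WD"
    unfolding WD_carrier h_def using p s bij_imp_bij_inv[OF p] by blast
  moreover have "h \<circ> g = id"
  proof -
    have "s (inv_into UNIV p i) * s (inv_into UNIV p i) = 1" for i
      using s[of "inv_into UNIV p i"] by auto
    moreover have "p \<circ> inv_into UNIV p = id"
      using p by (simp add: bij_is_surj surj_iff[symmetric])
    ultimately show ?thesis
      by (simp add: h_def g signed_perm_compose signed_perm_id)
  qed
  moreover have "g \<circ> h = id"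
  proof -
    have "s i * s i = 1" for i
      using s[of i] by auto
    then show ?thesis
      using p by (simp add: h_def g signed_perm_compose bij_is_inj signed_perm_id)
  qed
  ultimately show ?thesis
    using that by blast
qed

lemma subgroup_WD: "subgroup (carrier WD) orthogonal_group"
proof (rule subgroup_orthogonal_groupI)
  show "orthogonal_transformation g" if "g \<in> carrier WD" for g :: "real ^ 'n \<Rightarrow> real ^ 'n"
    using that by (elim WD_E) (simp add: orthogonal_transformation_signed_perm)
  show "(id :: real ^ 'n \<Rightarrow> real ^ 'n) \<in> carrier WD"
    unfolding WD_carrier
    by (intro CollectI exI[of _ "\<lambda>i. 1"] exI[of _ id]) (simp add: signed_perm_id)
  show "g \<circ> h \<in> carrier WD" if gW: "g \<in> carrier WD" and hW: "h \<in> carrier WD" for g h :: "real ^ 'n \<Rightarrow> real ^ 'n"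
  proof -
    obtain s :: "'n \<Rightarrow> real" and p where g: "g = signed_perm s p" and p: "bij p"
      and s: "\<And>i. s i = 1 \<or> s i = -1" and s1: "prod s UNIV = 1"
      using WD_E[OF gW] by metis
    obtain t :: "'n \<Rightarrow> real" and q where h: "h = signed_perm t q" and q: "bij q"
      and t: "\<And>i. t i = 1 \<or> t i = -1" and t1: "prod t UNIV = 1"
      using WD_E[OF hW] by metis
    have "s i * t (p i) = 1 \<or> s i * t (p i) = -1" for i
      using s[of i] t[of "p i"] by auto
    moreover have "(\<Prod>i\<in>UNIV. s i * t (p i)) = 1"
      by (simp add: prod.distrib s1 bij_prod_reindex[OF p] t1)
    ultimately show ?thesis
      unfolding WD_carrier g h signed_perm_compose using bij_comp[OF p q] by blast
  qed
  show "\<exists>h\<in>carrier WD. h \<circ> g = id" if "g \<in> carrier WD" for g :: "real ^ 'n \<Rightarrow> real ^ 'n"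
    using WD_inverse[OF that] by blast
qed

lemma subgroup_half_cube_group: "subgroup (carrier half_cube_group) orthogonal_group"
proof (rule subgroup_orthogonal_groupI)
  show "\<exists>h\<in>carrier half_cube_group. h \<circ> g = id"
    if "g \<in> carrier half_cube_group" for g :: "real ^ 'n \<Rightarrow> real ^ 'n"
  proof -
    have g: "orthogonal_transformation g" "g ` half_cube = half_cube"
      using that by (auto simp: carrier_half_cube_group)
    then have inj: "inj g"
      by (simp add: orthogonal_transformation_inj)
    have "inv_into UNIV g ` half_cube = half_cube"
      using g(2) inj by (metis image_inv_f_f)
    then show ?thesis
      using g(1) inj by (intro bexI[of _ "inv_into UNIV g"])
        (auto simp: carrier_half_cube_group orthogonal_transformation_inv)
  qed
  show "g \<circ> h \<in> carrier half_cube_group"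
    if "g \<in> carrier half_cube_group" "h \<in> carrier half_cube_group"
    for g h :: "real ^ 'n \<Rightarrow> real ^ 'n"
    using that image_comp[of g h half_cube]
    by (simp add: carrier_half_cube_group orthogonal_transformation_compose)
qed (auto simp: carrier_half_cube_group orthogonal_transformation_identity)

lemma WD_image_Psi_plus:
  assumes "g \<in> carrier WD"
  shows "g ` Psi_plus \<subseteq> Psi_plus" "g ` Psi_minus \<subseteq> Psi_minus"
  using assms
  by (elim WD_E; force simp: Psi_plus_iff Psi_minus_iff sign_prod_signed_perm signed_perm_in_Psi)+

lemma WD_linear:
  assumes "g \<in> carrier WD"
  shows "linear g"
  using assms by (elim WD_E) (simp add: linear_signed_perm)

text \<open>
Even signed permutations permute the vertices of the half cube.
\<close>

lemma WD_subset_half_cube_group: "carrier WD \<subseteq> carrier half_cube_group"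
proof
  fix g :: "real ^ 'n \<Rightarrow> real ^ 'n"
  assume g: "g \<in> carrier WD"
  have sub: "h ` half_cube \<subseteq> half_cube" if "h \<in> carrier WD" for h :: "real ^ 'n \<Rightarrow> real ^ 'n"
    using WD_image_Psi_plus(1)[OF that] WD_linear[OF that]
    by (simp add: half_cube_def convex_hull_linear_image hull_mono)
  obtain h where h: "h \<in> carrier WD" "g \<circ> h = id"
    using WD_inverse[OF g] .
  have "orthogonal_transformation g"
    using subgroup.subset[OF subgroup_WD] g by (auto simp: orthogonal_group_def)
  moreover have "half_cube \<subseteq> g ` half_cube"
    using sub[OF h(1)] h(2) by (metis image_comp image_id image_mono id_apply)
  ultimately show "g \<in> carrier half_cube_group"
    using sub[OF g] by (auto simp: carrier_half_cube_group)
qed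

lemma half_cube_group_eq: "half_cube_group = orthogonal_group\<lparr>carrier := carrier half_cube_group\<rparr>"
  and WD_eq: "WD = orthogonal_group\<lparr>carrier := carrier WD\<rparr>"
  by (simp_all add: half_cube_group_def WD_def)

lemma group_half_cube_group: "group half_cube_group"
  using subgroup.subgroup_is_group[OF subgroup_half_cube_group group_orthogonal_group]
  by (simp flip: half_cube_group_eq)

lemma group_WD: "group WD"
  using subgroup.subgroup_is_group[OF subgroup_WD group_orthogonal_group]
  by (simp flip: WD_eq)

lemma subgroup_WD_half_cube_group: "subgroup (carrier WD) half_cube_group"
  using group.subgroup_incl[OF group_orthogonal_group subgroup_WD subgroup_half_cube_group
      WD_subset_half_cube_group]
  by (simp flip: half_cube_group_eq)

lemma half_cube_group_face_of:
  assumes g: "g \<in> carrier half_cube_group" and F: "F face_of half_cube"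
  shows "g ` F face_of half_cube"
  using assms face_of_linear_image[of g F half_cube]
  by (auto simp: carrier_half_cube_group orthogonal_transformation_linear orthogonal_transformation_inj)

lemma half_cube_group_k_faces:
  assumes g: "g \<in> carrier half_cube_group" and F: "F \<in> k_faces k"
  shows "g ` F \<in> k_faces k"
proof -
  have "linear g" "inj g"
    using g by (auto simp: carrier_half_cube_group orthogonal_transformation_linear
        orthogonal_transformation_inj)
  then have "aff_dim (g ` F) = aff_dim F"
    by (rule aff_dim_injective_linear_image)
  then show ?thesis
    using F half_cube_group_face_of[OF g] by (auto simp: k_faces_def)
qed

lemma group_action_k_faces:
  assumes H: "subgroup H orthogonal_group" and sub: "H \<subseteq> carrier half_cube_group"
  shows "group_action (orthogonal_group\<lparr>carrier := H\<rparr>) (k_faces k) (face_action k)"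
proof -
  let ?G = "orthogonal_group\<lparr>carrier := H\<rparr>"
  have closed: "g ` F \<in> k_faces k" if "g \<in> H" "F \<in> k_faces k" for g F
    using that sub half_cube_group_k_faces by blast
  have Bij: "face_action k g \<in> Bij (k_faces k)" if g: "g \<in> H" for g
  proof -
    define h where "h = inv\<^bsub>orthogonal_group\<^esub> g"
    have h: "h \<in> H"
      using subgroup.m_inv_closed[OF H g] by (simp add: h_def)
    have "g \<in> carrier orthogonal_group"
      using g subgroup.subset[OF H] by blast
    then have hg: "h \<circ> g = id" and gh: "g \<circ> h = id"
      using group.l_inv[OF group_orthogonal_group] group.r_inv[OF group_orthogonal_group]
      by (auto simp: h_def orthogonal_group_def)
    have "bij_betw (\<lambda>F. g ` F) (k_faces k) (k_faces k)"
      by (rule bij_betw_byWitness[where f' = "\<lambda>F. h ` F"])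
        (auto simp: closed g h image_comp hg gh)
    then show ?thesis
      by (auto simp: Bij_def face_action_def cong: bij_betw_cong)
  qed
  have "face_action k \<in> hom ?G (BijGroup (k_faces k))"
  proof (rule homI)
    fix g h
    assume gh: "g \<in> carrier ?G" "h \<in> carrier ?G"
    have "face_action k (g \<circ> h) = compose (k_faces k) (face_action k g) (face_action k h)"
      using gh closed by (auto simp: fun_eq_iff compose_def face_action_def restrict_def image_comp)
    then show "face_action k (g \<otimes>\<^bsub>?G\<^esub> h)
        = face_action k g \<otimes>\<^bsub>BijGroup (k_faces k)\<^esub> face_action k h"
      using gh Bij by (simp add: BijGroup_def orthogonal_group_def)
  qed (simp add: Bij BijGroup_def)
  then show ?thesis
    by (simp add: group_action_def group_hom_def group_hom_axioms_def group_BijGroup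
        subgroup.subgroup_is_group[OF H group_orthogonal_group])
qed

lemma group_action_half_cube_group: "group_action half_cube_group (k_faces k) (face_action k)"
  using group_action_k_faces[OF subgroup_half_cube_group order_refl]
  by (simp flip: half_cube_group_eq)

lemma group_action_WD: "group_action WD (k_faces k) (face_action k)"
  using group_action_k_faces[OF subgroup_WD WD_subset_half_cube_group]
  by (simp flip: WD_eq)

lemma orbit_face_action:
  assumes "F \<in> k_faces k"
  shows "orbit G (face_action k) F = {g ` F | g. g \<in> carrier G}"
  using assms by (simp add: orbit_def face_action_def)

section \<open>Orbits of faces\<close>

lemma signed_perm_K_set:
  assumes g: "signed_perm s p \<in> carrier WD" and p: "bij p" and v: "v \<in> Psi_minus"
  shows "signed_perm s p ` K_set v S = K_set (signed_perm s p v) (p -` S)"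
proof -
  have gv: "signed_perm s p v \<in> Psi_minus"
    using WD_image_Psi_plus(2)[OF g] v by blast
  have "signed_perm s p ` K_set v S = (\<lambda>i. flip (p -` {i}) (signed_perm s p v)) ` S"
    by (simp add: K_set_eq[OF v] image_image signed_perm_flip)
  also have "\<dots> = (\<lambda>i. flip {i} (signed_perm s p v)) ` inv_into UNIV p ` S"
    using p by (simp add: image_image bij_vimage_eq_inv_image)
  also have "inv_into UNIV p ` S = p -` S"
    using p by (simp add: bij_vimage_eq_inv_image)
  finally show ?thesis
    by (simp add: K_set_eq[OF gv])
qed

lemma card_vimage_bij:
  fixes p :: "'n::finite \<Rightarrow> 'n"
  assumes "bij p"
  shows "card (p -` S) = card S"
  using assms by (simp add: card_vimage_inj bij_is_inj bij_is_surj)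

lemma signed_perm_L_set:
  assumes g: "signed_perm s p \<in> carrier WD" and p: "bij p" and v: "v \<in> Psi_plus"
  shows "signed_perm s p ` L_set v S = L_set (signed_perm s p v) (p -` S)"
proof -
  have gv: "signed_perm s p v \<in> Psi_plus"
    using WD_image_Psi_plus(1)[OF g] v by blast
  have card: "card (p -` A) = card A" for A
    using p by (rule card_vimage_bij)
  have *: "(\<exists>A. B = p -` A \<and> A \<subseteq> S \<and> even (card A)) \<longleftrightarrow> B \<subseteq> p -` S \<and> even (card B)" for B
  proof
    assume "B \<subseteq> p -` S \<and> even (card B)"
    moreover have "B = p -` (p ` B)"
      using p by (simp add: bij_is_inj inj_vimage_image_eq)
    ultimately show "\<exists>A. B = p -` A \<and> A \<subseteq> S \<and> even (card A)"
      using card[of "p ` B"] by (intro exI[of _ "p ` B"]) auto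
  qed (auto simp: card)
  have "signed_perm s p ` L_set v S
      = {flip B (signed_perm s p v) | B. \<exists>A. B = p -` A \<and> A \<subseteq> S \<and> even (card A)}"
    unfolding L_set_eq[OF v] by (force simp: signed_perm_flip)
  then show ?thesis
    unfolding * L_set_eq[OF gv] .
qed

text \<open>
Bijections between two sets and between their complements combine to a permutation.
\<close>

lemma bij_extending:
  fixes S T :: "'n::finite set"
  assumes "card S = card T"
  obtains p :: "'n \<Rightarrow> 'n" where "bij p" "p -` S = T"
proof -
  obtain f where f: "bij_betw f T S"
    using finite_same_card_bij[of T S] assms by auto
  obtain h where h: "bij_betw h (- T) (- S)"
    using finite_same_card_bij[of "- T" "- S"] assms by (auto simp: Compl_eq_Diff_UNIV card_Diff_subset)
  define p where "p i = (if i \<in> T then f i else h i)" for i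
  have "bij_betw p (T \<union> - T) (S \<union> - S)"
    unfolding p_def by (rule bij_betw_disjoint_Un[OF f h]) auto
  then have "bij p"
    by simp
  moreover have "p -` S = T"
    using bij_betwE[OF f] bij_betwE[OF h] by (auto simp: p_def split: if_splits)
  ultimately show ?thesis
    using that by blast
qed

text \<open>
Once the permutation is chosen, the signs are forced, and equal parity of \<open>v\<close> and \<open>w\<close> makes the number
of sign changes even.
\<close>

lemma WD_transitive:
  fixes v w :: "real ^ 'n"
  assumes v: "v \<in> Psi" and w: "w \<in> Psi" and vw: "sign_prod v = sign_prod w"
    and card: "card S = card T"
  obtains s p where "signed_perm s p \<in> carrier WD" "bij p" "signed_perm s p v = w" "p -` S = T"
proof -
  obtain p :: "'n \<Rightarrow> 'n" where p: "bij p" "p -` S = T"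
    using bij_extending[OF card] .
  define s where "s i = w $ i * v $ p i" for i
  have "s i = 1 \<or> s i = -1" for i
    using v w unfolding s_def Psi_iff by (metis mult_1 mult_minus1 minus_minus)
  moreover have "prod s UNIV = sign_prod w * sign_prod v"
    using bij_prod_reindex[OF p(1), of "\<lambda>i. v $ i"]
    by (simp add: s_def prod.distrib sign_prod_def)
  then have "prod s UNIV = 1"
    using vw by (simp add: sign_prod_eq[OF w] flip: power_mult_distrib)
  ultimately have "signed_perm s p \<in> carrier WD"
    unfolding WD_carrier using p(1) by blast
  moreover have "signed_perm s p v = w"
    by (simp add: signed_perm_def s_def vec_eq_iff mult.assoc Psi_square[OF v])
  ultimately show ?thesis
    using that p by blast
qed

lemma WD_image_convex_hull:
  assumes "g \<in> carrier WD"
  shows "g ` (convex hull A) = convex hull (g ` A)"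
  by (rule convex_hull_linear_image[OF WD_linear[OF assms]])

lemma WD_orbit_K:
  fixes F :: "(real ^ 'n) set"
  assumes F: "F \<in> K_faces k"
  shows "{g ` F | g. g \<in> carrier WD} = K_faces k"
proof -
  obtain v :: "real ^ 'n" and S where v: "v \<in> Psi_minus" and S: "card S = k + 1" and FK: "F = convex hull K_set v S"
    using F by (auto simp: K_faces_def)
  show ?thesis
  proof (intro equalityI subsetI)
    fix E :: "(real ^ 'n) set"
    assume "E \<in> {g ` F | g. g \<in> carrier WD}"
    then obtain g where g: "g \<in> carrier WD" "E = g ` F"
      by blast
    then obtain s p where sp: "g = signed_perm s p" "bij p"
      by (elim WD_E) auto
    have "E = convex hull K_set (g v) (p -` S)"
      using signed_perm_K_set[of s p v S] g sp v FK by (simp add: WD_image_convex_hull)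
    moreover have "g v \<in> Psi_minus"
      using WD_image_Psi_plus(2)[OF g(1)] v by blast
    ultimately show "E \<in> K_faces k"
      using card_vimage_bij[OF sp(2), of S] S by (auto simp: K_faces_def)
  next
    fix E :: "(real ^ 'n) set"
    assume "E \<in> K_faces k"
    then obtain w :: "real ^ 'n" and T where w: "w \<in> Psi_minus" "card T = k + 1" "E = convex hull K_set w T"
      by (auto simp: K_faces_def)
    obtain s p where sp: "signed_perm s p \<in> carrier WD" "bij p" "signed_perm s p v = w" "p -` S = T"
      using WD_transitive[of v w S T] v w S by (auto simp: Psi_minus_iff)
    have "signed_perm s p ` F = E"
      using signed_perm_K_set[OF sp(1,2) v, of S] sp w FK by (simp add: WD_image_convex_hull)
    then show "E \<in> {g ` F | g. g \<in> carrier WD}"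
      using sp(1) by blast
  qed
qed

lemma WD_image_L_set:
  assumes g: "g \<in> carrier WD" and v: "v \<in> Psi_plus"
  obtains T where "g v \<in> Psi_plus" "card T = card S" "g ` (convex hull L_set v S) = convex hull L_set (g v) T"
proof -
  obtain s p where sp: "g = signed_perm s p" "bij p"
    using g by (elim WD_E) auto
  have "g ` (convex hull L_set v S) = convex hull L_set (g v) (p -` S)"
    using signed_perm_L_set[of s p v S] g sp v by (simp add: WD_image_convex_hull)
  moreover have "g v \<in> Psi_plus"
    using WD_image_Psi_plus(1)[OF g(1)] v by blast
  ultimately show ?thesis
    using card_vimage_bij[OF sp(2), of S] that by blast
qed

lemma WD_orbit_L:
  fixes F :: "(real ^ 'n) set"
  assumes F: "F \<in> L_faces k"
  shows "{g ` F | g. g \<in> carrier WD} = L_faces k"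
proof -
  obtain v :: "real ^ 'n" and S where v: "v \<in> Psi_plus" and S: "card S = k" and FL: "F = convex hull L_set v S"
    using F by (auto simp: L_faces_def)
  show ?thesis
  proof (intro equalityI subsetI)
    fix E :: "(real ^ 'n) set"
    assume "E \<in> {g ` F | g. g \<in> carrier WD}"
    then obtain g where g: "g \<in> carrier WD" "E = g ` F"
      by blast
    obtain T where "g v \<in> Psi_plus" "card T = card S" "E = convex hull L_set (g v) T"
      using WD_image_L_set[OF g(1) v, of S] g(2) FL by metis
    then show "E \<in> L_faces k"
      using S by (auto simp: L_faces_def)
  next
    fix E :: "(real ^ 'n) set"
    assume "E \<in> L_faces k"
    then obtain w :: "real ^ 'n" and T where w: "w \<in> Psi_plus" "card T = k" "E = convex hull L_set w T"
      by (auto simp: L_faces_def)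
    obtain s p where sp: "signed_perm s p \<in> carrier WD" "bij p" "signed_perm s p v = w" "p -` S = T"
      using WD_transitive[of v w S T] v w S by (auto simp: Psi_plus_iff)
    have "signed_perm s p ` F = E"
      using signed_perm_L_set[OF sp(1,2) v, of S] sp w FL by (simp add: WD_image_convex_hull)
    then show "E \<in> {g ` F | g. g \<in> carrier WD}"
      using sp(1) by blast
  qed
qed

lemma K_faces_nonempty:
  assumes "k < CARD('n)"
  shows "(K_faces k :: (real ^ 'n) set set) \<noteq> {}"
proof -
  obtain S :: "'n set" where "card S = k + 1"
    using obtain_subset_with_card_n[of "k + 1" "UNIV :: 'n set"] assms by auto
  then show ?thesis
    using flip_Psi_minus[OF one_Psi_plus, of undefined] by (auto simp: K_faces_def)
qed

lemma K_faces_top: "(K_faces CARD('n) :: (real ^ 'n) set set) = {}"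
proof -
  have "card S \<noteq> CARD('n) + 1" for S :: "'n set"
    using card_mono[of UNIV S] by simp
  then show ?thesis
    by (simp add: K_faces_def)
qed

lemma L_faces_nonempty:
  assumes "k \<le> CARD('n)"
  shows "(L_faces k :: (real ^ 'n) set set) \<noteq> {}"
proof -
  obtain S :: "'n set" where "card S = k"
    using obtain_subset_with_card_n[of k "UNIV :: 'n set"] assms by auto
  then show ?thesis
    using one_Psi_plus by (auto simp: L_faces_def)
qed

text \<open>
The vertices of \<open>K_set v S\<close> vary in all \<open>k + 1\<close> coordinates of \<open>S\<close>, those of \<open>L_set w T\<close> only in the
\<open>k\<close> coordinates of \<open>T\<close>.
\<close>

lemma K_faces_Int_L_faces:
  assumes "k \<ge> 1"
  shows "(K_faces k :: (real ^ 'n) set set) \<inter> L_faces k = {}"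
proof (rule ccontr)
  assume "(K_faces k :: (real ^ 'n) set set) \<inter> L_faces k \<noteq> {}"
  then obtain v w :: "real ^ 'n" and S T where v: "v \<in> Psi_minus" "card S = k + 1"
    and w: "w \<in> Psi_plus" "card T = k" and eq: "convex hull K_set v S = convex hull L_set w T"
    unfolding K_faces_def L_faces_def by blast
  have KL: "K_set v S = L_set w T"
    using eq by (simp add: convex_hull_inject K_set_subset L_set_subset)
  have "i \<in> T" if i: "i \<in> S" for i
  proof (rule ccontr)
    assume "i \<notin> T"
    have "card (S - {i}) > 0"
      using v assms i by simp
    then obtain j where j: "j \<in> S" "j \<noteq> i"
      by (metis Diff_iff card_gt_0_iff ex_in_conv singletonI)
    have "flip {i} v \<in> L_set w T" "flip {j} v \<in> L_set w T"
      using i j v by (auto simp: K_set_eq simp flip: KL)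
    then have "flip {i} v $ i = flip {j} v $ i"
      using \<open>i \<notin> T\<close> unfolding L_set_def by auto
    then show False
      using j v by (auto simp: Psi_nonzero Psi_minus_iff)
  qed
  then have "card S \<le> card T"
    by (intro card_mono) auto
  then show False
    using v w by simp
qed

lemma orbits_WD:
  assumes k: "k \<le> CARD('n)"
  shows "orbits WD (k_faces k :: (real ^ 'n) set set) (face_action k)
    = (if k < CARD('n) then {K_faces k} else {}) \<union> (if 3 \<le> k then {L_faces k} else {})"
proof -
  let ?K = "K_faces k :: (real ^ 'n) set set" and ?L = "L_faces k :: (real ^ 'n) set set"
  let ?orb = "orbit WD (face_action k)"
  have K: "?orb ` ?K = (if k < CARD('n) then {?K} else {})"
  proof -
    have "?orb F = ?K" if "F \<in> ?K" for F
      using that by (simp add: orbit_face_action k_faces_eq WD_orbit_K)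
    then have "?orb ` ?K = (\<lambda>F. ?K) ` ?K"
      by (rule image_cong[OF refl])
    moreover have "?K = {}" if "\<not> k < CARD('n)"
      using that k K_faces_top by (metis le_neq_implies_less)
    ultimately show ?thesis
      using K_faces_nonempty[where 'n = 'n, of k] by auto
  qed
  have L: "?orb ` ?L = {?L}" if "3 \<le> k"
  proof -
    have "?orb F = ?L" if "F \<in> ?L" for F
      using that \<open>3 \<le> k\<close> by (simp add: orbit_face_action k_faces_eq WD_orbit_L)
    then have "?orb ` ?L = (\<lambda>F. ?L) ` ?L"
      by (rule image_cong[OF refl])
    then show ?thesis
      using L_faces_nonempty[where 'n = 'n, OF k] by auto
  qed
  have "orbits WD (k_faces k :: (real ^ 'n) set set) (face_action k) = ?orb ` k_faces k"
    by (auto simp: orbits_def)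
  also have "\<dots> = ?orb ` ?K \<union> (if 3 \<le> k then ?orb ` ?L else {})"
    by (simp add: k_faces_eq image_Un)
  finally show ?thesis
    using K L by simp
qed

lemma inner_flips_minus:
  fixes v :: "real ^ 'n"
  assumes "v \<in> Psi" "i \<noteq> j"
  shows "flip {i} v \<bullet> flip {j} v = real CARD('n) - 4"
proof -
  have "flip {i} v \<bullet> flip {j} v = flip {i} v \<bullet> v - 2"
    using assms Psi_square[OF assms(1), of j] by (simp add: inner_flip)
  also have "flip {i} v \<bullet> v = v \<bullet> flip {i} v"
    by (rule inner_commute)
  also have "v \<bullet> flip {i} v = real CARD('n) - 2"
    using assms Psi_square[OF assms(1), of i] by (simp add: inner_flip Psi_inner_self)
  finally show ?thesis
    by simp
qed

text \<open>
The vertices are the extreme points of the half cube.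
\<close>

lemma half_cube_group_Psi_plus:
  assumes g: "g \<in> carrier half_cube_group"
  shows "g ` Psi_plus \<subseteq> Psi_plus"
proof
  fix w
  assume "w \<in> g ` Psi_plus"
  then obtain v where v: "v \<in> Psi_plus" "w = g v"
    by blast
  have "L_set v {} = {v}"
    using v by (simp add: L_set_eq)
  then have "{v} face_of half_cube"
    using face_L_set[OF v(1), of "{}"] by simp
  from half_cube_group_face_of[OF g this] have "w extreme_point_of half_cube"
    using v by (simp add: face_of_singleton)
  then show "w \<in> Psi_plus"
    by (simp add: half_cube_def extreme_point_of_convex_hull)
qed

text \<open>
An isometry preserves inner products of vertices.  For \<open>k \<ge> 4\<close> the inner products inside the face
distinguish the types.  For \<open>k = 3\<close> they do not, and the position of the face relative to the other
vertices is used: a coordinate outside \<open>S\<close>, which exists because \<open>n > 4\<close>, gives a vertex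
\<open>flip {j} v\<close> with the same inner product with all vertices of the \<open>K\<close>-face.
\<close>

lemma half_cube_group_not_K_to_L:
  fixes v w :: "real ^ 'n"
  assumes n: "CARD('n) > 4" and g: "g \<in> carrier half_cube_group"
    and v: "v \<in> Psi_minus" and S: "card S = k + 1" and w: "w \<in> Psi_plus" and T: "card T = k"
    and k: "3 \<le> k"
    and eq: "g ` (convex hull K_set v S) = convex hull L_set w T"
  shows False
proof -
  have og: "orthogonal_transformation g"
    using g by (simp add: carrier_half_cube_group)
  then have inner: "g x \<bullet> g y = x \<bullet> y" for x y
    by (simp add: orthogonal_transformation_def)
  have v': "v \<in> Psi" and w': "w \<in> Psi"
    using v w by (auto simp: Psi_minus_iff Psi_plus_iff)
  have "convex hull (g ` K_set v S) = convex hull L_set w T"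
    using eq og by (simp add: convex_hull_linear_image orthogonal_transformation_linear)
  moreover have "g ` K_set v S \<subseteq> Psi_plus"
    using half_cube_group_Psi_plus[OF g] K_set_subset by blast
  ultimately have KL: "g ` K_set v S = L_set w T"
    by (simp add: convex_hull_inject L_set_subset)
  show False
  proof (cases "k = 3")
    case False
    \<comment> \<open>With four free coordinates there are vertices at Hamming distance four.\<close>
    then obtain A where A: "A \<subseteq> T" "card A = 4"
      using T k obtain_subset_with_card_n[of 4 T] by auto
    have "w \<in> g ` K_set v S" "flip A w \<in> g ` K_set v S"
      using A w by (auto simp: KL L_set_eq intro: exI[of _ A] exI[of _ "{}"])
    then obtain i j where ij: "w = g (flip {i} v)" "flip A w = g (flip {j} v)"
      using v by (auto simp: K_set_eq)
    have "w \<bullet> flip A w = real CARD('n) - 8"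
      using A by (simp add: inner_flip Psi_inner_self[OF w'] Psi_square[OF w'])
    moreover have "w \<bullet> flip A w = flip {i} v \<bullet> flip {j} v"
      unfolding ij(2) by (subst ij(1)) (rule inner)
    moreover have "flip {i} v \<bullet> flip {j} v \<ge> real CARD('n) - 4"
      using v' by (cases "i = j") (auto simp: Psi_inner_self inner_flips_minus)
    ultimately show False
      by simp
  next
    case True
    have "S \<noteq> UNIV"
      using S n True by auto
    then obtain j where j: "j \<notin> S"
      by blast
    define z where "z = g (flip {j} v)"
    have const: "z \<bullet> y = real CARD('n) - 4" if y: "y \<in> L_set w T" for y
    proof -
      obtain i where "i \<in> S" "y = g (flip {i} v)"
        using y v by (auto simp: K_set_eq simp flip: KL)
      then show ?thesis
        using j v' by (auto simp: z_def inner intro!: inner_flips_minus)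
    qed
    have "z \<in> Psi_plus"
      using half_cube_group_Psi_plus[OF g] flip_Psi_plus[OF v] by (auto simp: z_def)
    have opp: "z $ a * w $ a + z $ b * w $ b = 0" if "a \<in> T" "b \<in> T" "a \<noteq> b" for a b
    proof -
      have "flip {a, b} w \<in> L_set w T"
        using that w by (auto simp: L_set_def flip2_Psi_plus)
      from const[OF this] const[OF L_set_self[OF w, of T]]
      have "(\<Sum>i\<in>{a, b}. z $ i * w $ i) = 0"
        unfolding inner_flip by linarith
      then show ?thesis
        using that by simp
    qed
    obtain a b c where abc: "T = {a, b, c}" "a \<noteq> b" "a \<noteq> c" "b \<noteq> c"
      using T True by (metis card_3_iff)
    have "z $ a * w $ a + z $ b * w $ b = 0" "z $ a * w $ a + z $ c * w $ c = 0"
      "z $ b * w $ b + z $ c * w $ c = 0"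
      using opp[of a b] opp[of a c] opp[of b c] abc by simp_all
    then have "z $ a * w $ a = 0"
      by linarith
    then show False
      using w' \<open>z \<in> Psi_plus\<close> by (simp add: Psi_nonzero Psi_plus_iff)
  qed
qed

lemma orbits_half_cube_group:
  assumes n: "CARD('n) > 4" and k: "k \<le> CARD('n)"
  shows "orbits half_cube_group (k_faces k :: (real ^ 'n) set set) (face_action k)
    = orbits WD (k_faces k) (face_action k)"
proof -
  let ?G = "half_cube_group :: (real ^ 'n \<Rightarrow> real ^ 'n) monoid"
  have not_KL: "E \<notin> L_faces k" if F: "F \<in> K_faces k" and g: "g \<in> carrier ?G" "E = g ` F" and "3 \<le> k"
    for E F g
  proof
    assume E: "E \<in> L_faces k"
    obtain v S where "v \<in> Psi_minus" "card S = k + 1" "F = convex hull K_set v S"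
      using F by (auto simp: K_faces_def)
    moreover obtain w T where "w \<in> Psi_plus" "card T = k" "E = convex hull L_set w T"
      using E by (auto simp: L_faces_def)
    ultimately show False
      using half_cube_group_not_K_to_L[OF n g(1)] \<open>3 \<le> k\<close> g(2) by blast
  qed
  have orb: "{g ` F | g. g \<in> carrier ?G} = {g ` F | g. g \<in> carrier WD}" if F: "F \<in> k_faces k" for F
  proof
    show "{g ` F | g. g \<in> carrier WD} \<subseteq> {g ` F | g. g \<in> carrier ?G}"
      using WD_subset_half_cube_group by blast
    show "{g ` F | g. g \<in> carrier ?G} \<subseteq> {g ` F | g. g \<in> carrier WD}"
    proof
      fix E
      assume "E \<in> {g ` F | g. g \<in> carrier ?G}"
      then obtain g where g: "g \<in> carrier ?G" "E = g ` F"
        by blast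
      have E: "E \<in> k_faces k"
        using half_cube_group_k_faces[OF g(1) F] g(2) by simp
      show "E \<in> {g ` F | g. g \<in> carrier WD}"
      proof (cases "F \<in> K_faces k")
        case True
        then have "E \<in> K_faces k"
          using E not_KL[OF True g] by (auto simp: k_faces_eq split: if_splits)
        then show ?thesis
          using WD_orbit_K[OF True] by simp
      next
        case False
        then have L: "F \<in> L_faces k" and k3: "3 \<le> k"
          using F by (auto simp: k_faces_eq split: if_splits)
        have "E \<notin> K_faces k"
        proof
          assume EK: "E \<in> K_faces k"
          have "bij g" and og: "orthogonal_transformation g"
            using g by (auto simp: carrier_half_cube_group orthogonal_transformation_bij)
          have "inv_into UNIV g \<in> carrier ?G"
            using g og by (simp add: carrier_half_cube_group orthogonal_transformation_inv)
              (metis \<open>bij g\<close> bij_is_inj image_inv_f_f)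
          moreover have "F = inv_into UNIV g ` E"
            using g \<open>bij g\<close> by (simp add: bij_is_inj image_inv_f_f)
          ultimately show False
            using not_KL[OF EK] L k3 by blast
        qed
        then have "E \<in> L_faces k"
          using E by (auto simp: k_faces_eq split: if_splits)
        then show ?thesis
          using WD_orbit_L[OF L] by simp
      qed
    qed
  qed
  then have "orbit ?G (face_action k) F = orbit WD (face_action k) F" if "F \<in> k_faces k" for F
    using that by (simp add: orbit_face_action)
  then have "orbit ?G (face_action k) ` k_faces k = orbit WD (face_action k) ` k_faces k"
    by (rule image_cong[OF refl])
  then show ?thesis
    by (simp add: orbits_def Setcompr_eq_image)
qed

section \<open>Dimension four\<close>

text \<open>
For \<open>n = 4\<close> the vector \<open>1\<close> has squared length four, and this is the reflection in the hyperplane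
orthogonal to it.
\<close>

definition diagonal_reflection :: "real ^ 'n \<Rightarrow> real ^ 'n" where
  "diagonal_reflection x = x - (x \<bullet> 1 / 2) *\<^sub>R 1"

lemma diagonal_reflection_one:
  assumes "CARD('n) = 4"
  shows "diagonal_reflection (1 :: real ^ 'n) = - 1"
  using assms by (simp add: diagonal_reflection_def vec_eq_iff inner_vec_def)

lemma diagonal_reflection_flip:
  fixes A :: "'n::finite set"
  assumes "CARD('n) = 4" "card A = 2"
  shows "diagonal_reflection (flip A (1 :: real ^ 'n)) = flip A 1"
proof -
  have "flip A (1 :: real ^ 'n) \<bullet> 1 = 1 \<bullet> flip A (1 :: real ^ 'n)"
    by (rule inner_commute)
  also have "\<dots> = 0"
    using assms by (simp add: inner_flip) (simp add: inner_vec_def)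
  finally show ?thesis
    by (simp add: diagonal_reflection_def)
qed

lemma diagonal_reflection_involution:
  assumes "CARD('n) = 4"
  shows "diagonal_reflection (diagonal_reflection (x :: real ^ 'n)) = x"
proof -
  have "(1 :: real ^ 'n) \<bullet> 1 = 4"
    using assms by (simp add: inner_vec_def)
  then show ?thesis
    by (simp add: diagonal_reflection_def inner_diff algebra_simps)
qed

text \<open>
In dimension four an even sign vector is \<open>1\<close>, \<open>- 1\<close>, or orthogonal to \<open>1\<close>, so the reflection permutes
the vertices.
\<close>

lemma diagonal_reflection_half_cube_group:
  assumes n: "CARD('n) = 4"
  shows "(diagonal_reflection :: real ^ 'n \<Rightarrow> real ^ 'n) \<in> carrier half_cube_group"
proof -
  let ?r = "diagonal_reflection :: real ^ 'n \<Rightarrow> real ^ 'n"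
  have one: "(1 :: real ^ 'n) \<bullet> 1 = 4"
    using n by (simp add: inner_vec_def)
  have lin: "linear ?r"
    by (rule linearI) (auto simp: diagonal_reflection_def inner_add_left algebra_simps add_divide_distrib scaleR_add_left)
  have "?r x \<bullet> ?r y = x \<bullet> y" for x y
    using one by (simp add: diagonal_reflection_def inner_diff inner_commute field_simps)
  with lin have orth: "orthogonal_transformation ?r"
    by (simp add: orthogonal_transformation_def)
  have Psi: "?r v \<in> Psi_plus" if v: "v \<in> Psi_plus" for v
  proof -
    obtain A where A: "v = flip A 1" "even (card A)"
      using v L_set_eq[OF one_Psi_plus, of "UNIV :: 'n set"] by (auto simp: L_set_UNIV)
    have "card A \<le> 4"
      using card_mono[of UNIV A] n by simp
    moreover obtain m where "card A = 2 * m"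
      using A(2) by blast
    ultimately have "card A = 0 \<or> card A = 2 \<or> card A = 4"
      by presburger
    then show ?thesis
    proof (elim disjE)
      assume "card A = 0"
      then have "?r v = - 1"
        using n A by (simp add: diagonal_reflection_one)
      also have "\<dots> = flip UNIV 1"
        by (simp add: vec_eq_iff)
      also have "\<dots> \<in> Psi_plus"
        using one_Psi_plus[where 'a = 'n] n by (simp add: Psi_plus_iff)
      finally show ?thesis .
    next
      assume "card A = 2"
      then show ?thesis
        using n A v by (simp add: diagonal_reflection_flip)
    next
      assume "card A = 4"
      then have "A = UNIV"
        using n by (intro card_subset_eq) auto
      then have "v = - 1"
        using A by (simp add: vec_eq_iff)
      then have "?r v = 1"
        using diagonal_reflection_one[OF n] diagonal_reflection_involution[OF n] by metis
      then show ?thesis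
        by (simp add: one_Psi_plus)
    qed
  qed
  then have sub: "?r ` half_cube \<subseteq> half_cube"
    unfolding half_cube_def convex_hull_linear_image[OF lin] by (intro hull_mono) blast
  have "x \<in> ?r ` half_cube" if "x \<in> half_cube" for x
    using sub that diagonal_reflection_involution[OF n, of x] by (metis image_eqI image_subset_iff)
  then show ?thesis
    using sub orth by (auto simp: carrier_half_cube_group)
qed

text \<open>
The image of an \<open>L\<close>-face under the reflection is a face in which no coordinate is constant; an
\<open>L\<close>-face of dimension three has a constant coordinate.
\<close>

lemma diagonal_reflection_L_to_K:
  assumes n: "CARD('n) = 4"
  obtains F :: "(real ^ 'n) set" where "F \<in> L_faces 3" "diagonal_reflection ` F \<in> K_faces 3"
proof -
  let ?r = "diagonal_reflection :: real ^ 'n \<Rightarrow> real ^ 'n"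
  obtain S :: "'n set" where S: "card S = 3"
    using obtain_subset_with_card_n[of 3 "UNIV :: 'n set"] n by auto
  define F :: "(real ^ 'n) set" where "F = convex hull L_set 1 S"
  have F: "F \<in> L_faces 3"
    using S one_Psi_plus by (auto simp: L_faces_def F_def)
  then have "?r ` F \<in> k_faces 3"
    by (intro half_cube_group_k_faces diagonal_reflection_half_cube_group n) (simp add: k_faces_eq)
  moreover have "?r ` F \<notin> L_faces 3"
  proof
    assume "?r ` F \<in> L_faces 3"
    then obtain w :: "real ^ 'n" and T where w: "w \<in> Psi_plus" and T: "card T = 3"
      and rF: "?r ` F = convex hull L_set w T"
      by (auto simp: L_faces_def)
    have mem: "?r x \<in> L_set w T" if "x \<in> L_set 1 S" for x
    proof -
      have "?r x \<in> Psi_plus \<inter> convex hull L_set w T"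
        using that half_cube_group_Psi_plus[OF diagonal_reflection_half_cube_group[OF n]]
          L_set_subset[of 1 S] by (auto simp: F_def hull_inc simp flip: rF)
      then show ?thesis
        by (simp add: Psi_plus_inter_convex_hull L_set_subset)
    qed
    have flips: "flip {a, b} 1 \<in> L_set w T" if "a \<in> S" "b \<in> S" "a \<noteq> b" for a b
      using mem[of "flip {a, b} 1"] that n diagonal_reflection_flip[of "{a, b}"]
      by (simp add: L_set_def flip2_Psi_plus one_Psi_plus)
    have neg: "- 1 \<in> L_set w T"
      using mem[OF L_set_self[OF one_Psi_plus]] diagonal_reflection_one[OF n] by simp
    have "T \<noteq> UNIV"
      using T n by auto
    then obtain i where i: "i \<notin> T"
      by blast
    obtain a b c where abc: "S = {a, b, c}" "a \<noteq> b" "a \<noteq> c" "b \<noteq> c"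
      using S by (metis card_3_iff)
    \<comment> \<open>No coordinate is constant on the image: - 1 and the three double flips already vary everywhere.\<close>
    have "w $ i = - 1" "w $ i = flip {a, b} 1 $ i" "w $ i = flip {a, c} 1 $ i" "w $ i = flip {b, c} 1 $ i"
      using i neg flips abc unfolding L_set_def by auto
    then show False
      using abc by (auto split: if_splits)
  qed
  ultimately have "?r ` F \<in> K_faces 3"
    by (simp add: k_faces_eq)
  with F show ?thesis
    using that by blast
qed


text \<open>
Only \<open>k = 3\<close> involves two orbits of the smaller group, and the reflection merges them.
\<close>

lemma orbits_half_cube_group_4:
  assumes n: "CARD('n) = 4" and k: "k \<le> CARD('n)"
  shows "orbits half_cube_group (k_faces k :: (real ^ 'n) set set) (face_action k) = {k_faces k}"
proof -
  let ?G = "half_cube_group :: (real ^ 'n \<Rightarrow> real ^ 'n) monoid"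
  interpret group_action ?G "k_faces k" "face_action k"
    by (rule group_action_half_cube_group)
  have W: "orbit WD (face_action k) F \<subseteq> orbit ?G (face_action k) F" for F
    unfolding orbit_def using WD_subset_half_cube_group by blast
  have K: "K_faces k \<subseteq> orbit ?G (face_action k) F" if "F \<in> K_faces k" for F
    using W[of F] WD_orbit_K[OF that] that by (simp add: orbit_face_action[of F] k_faces_eq)
  have L: "L_faces k \<subseteq> orbit ?G (face_action k) F" if "F \<in> L_faces k" "3 \<le> k" for F
    using W[of F] WD_orbit_L[OF that(1)] that by (simp add: orbit_face_action[of F] k_faces_eq)
  have "\<exists>F\<in>k_faces k. k_faces k \<subseteq> orbit ?G (face_action k) F"
  proof -
    consider "k < 3" | "k = 3" | "k = CARD('n)"
      using n k by linarith
    then show ?thesis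
    proof cases
      case 1
      then show ?thesis
        using K K_faces_nonempty[where 'n = 'n, of k] n by (auto simp: k_faces_eq)
    next
      case 3
      then show ?thesis
        using L L_faces_nonempty[where 'n = 'n, of k] K_faces_top[where 'n = 'n] n
        by (auto simp: k_faces_eq)
    next
      case 2
      obtain F :: "(real ^ 'n) set" where F: "F \<in> L_faces 3" "diagonal_reflection ` F \<in> K_faces 3"
        using diagonal_reflection_L_to_K[OF n] .
      let ?E = "diagonal_reflection ` F"
      have Fk: "F \<in> k_faces k" "?E \<in> k_faces k"
        using F 2 by (auto simp: k_faces_eq)
      have E: "?E \<in> orbit ?G (face_action k) F"
        using diagonal_reflection_half_cube_group[OF n] Fk by (auto simp: orbit_face_action)
      have "K_faces k \<subseteq> orbit ?G (face_action k) F"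
      proof
        fix D :: "(real ^ 'n) set"
        assume D: "D \<in> K_faces k"
        then have "D \<in> orbit ?G (face_action k) ?E"
          using K[of ?E] F(2) 2 by auto
        with E show "D \<in> orbit ?G (face_action k) F"
          using orbit_trans[OF Fk(1) Fk(2) _ E] D by (auto simp: k_faces_eq)
      qed
      then show ?thesis
        using L[of F] F(1) 2 Fk by (auto simp: k_faces_eq)
    qed
  qed
  then obtain F where F: "F \<in> k_faces k" "k_faces k \<subseteq> orbit ?G (face_action k) F"
    by blast
  have sub: "orbit ?G (face_action k) E \<subseteq> k_faces k" if "E \<in> k_faces k" for E
    using that half_cube_group_k_faces by (auto simp: orbit_face_action)
  have "orbit ?G (face_action k) E = k_faces k" if E: "E \<in> k_faces k" for E
  proof
    have FE: "F \<in> orbit ?G (face_action k) E"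
      using orbit_sym[OF F(1) E] F(2) E by blast
    show "k_faces k \<subseteq> orbit ?G (face_action k) E"
    proof
      fix D :: "(real ^ 'n) set"
      assume D: "D \<in> k_faces k"
      then show "D \<in> orbit ?G (face_action k) E"
        using orbit_trans[OF E F(1) D FE] F(2) by blast
    qed
  qed (rule sub[OF E])
  then show ?thesis
    using F(1) by (auto simp: orbits_def)
qed

section \<open>The subcomplex and the action on its homology\<close>

text \<open>
The three kinds of cells are uniformly the relative interiors of the nonempty faces, since a point is
its own relative interior and the half cube has full dimension.
\<close>

lemma cells_eq:
  assumes n: "CARD('n) \<ge> 3"
  shows "(cells :: (real ^ 'n) set set) = {rel_interior F | F. F face_of half_cube \<and> F \<noteq> {}}"
proof (intro equalityI subsetI)
  fix e :: "(real ^ 'n) set"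
  assume "e \<in> cells"
  then consider "e \<in> k_faces 0" | F k where "F \<in> k_faces k" "e = rel_interior F"
    | "e = interior half_cube"
    unfolding cells_def by blast
  then show "e \<in> {rel_interior F | F. F face_of half_cube \<and> F \<noteq> {}}"
  proof cases
    case 1
    then obtain a where "e = {a}" "e face_of half_cube"
      by (auto simp: k_faces_def aff_dim_eq_0)
    then show ?thesis
      by (intro CollectI exI[of _ "{a}"]) simp
  next
    case 2
    then show ?thesis
      by (auto simp: k_faces_def)
  next
    case 3
    have "interior (half_cube :: (real ^ 'n) set) = rel_interior half_cube"
      using aff_dim_half_cube[OF n] by (simp add: rel_interior_interior flip: aff_dim_eq_full)
    moreover have "(half_cube :: (real ^ 'n) set) face_of half_cube"
      by (simp add: face_of_refl half_cube_def)
    moreover have "(half_cube :: (real ^ 'n) set) \<noteq> {}"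
      using one_Psi_plus by (auto simp: half_cube_def)
    ultimately show ?thesis
      using 3 by blast
  qed
next
  fix e :: "(real ^ 'n) set"
  assume "e \<in> {rel_interior F | F. F face_of half_cube \<and> F \<noteq> {}}"
  then obtain F where F: "F face_of half_cube" "F \<noteq> {}" "e = rel_interior F"
    by blast
  define k where "k = nat (aff_dim F)"
  have "aff_dim F \<ge> 0"
    using F(2) aff_dim_geq[of F] by (simp add: aff_dim_empty)
  then have k: "aff_dim F = int k"
    by (simp add: k_def)
  then have Fk: "F \<in> k_faces k"
    using F by (simp add: k_faces_def)
  have "k \<le> CARD('n)"
    using aff_dim_le_DIM[of F] k by simp
  then consider "k = 0" | "0 < k" "k < CARD('n)" | "k = CARD('n)"
    by linarith
  then show "e \<in> cells"
  proof cases
    case 1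
    then obtain a where "F = {a}"
      using k by (auto simp: aff_dim_eq_0)
    then show ?thesis
      using Fk F 1 by (auto simp: cells_def)
  next
    case 2
    then show ?thesis
      using Fk F by (auto simp: cells_def)
  next
    case 3
    then have "aff_dim F = aff_dim (half_cube :: (real ^ 'n) set)"
      using k n by (simp add: aff_dim_half_cube)
    then have "F = half_cube"
      using face_of_aff_dim_lt[of half_cube F] F(1) by (auto simp: half_cube_def)
    moreover have "interior F = rel_interior F"
      using k 3 by (simp add: rel_interior_interior flip: aff_dim_eq_full)
    ultimately show ?thesis
      using F(3) by (auto simp: cells_def)
  qed
qed

lemma closure_rel_interior_face:
  fixes F :: "(real ^ 'n) set"
  assumes "F face_of half_cube"
  shows "closure (rel_interior F) = F"
proof -
  have "compact F" "convex F"
    using face_of_imp_compact[OF _ _ assms] face_of_imp_convex[OF assms]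
      polytope_imp_compact[OF polytope_half_cube] polytope_imp_convex[OF polytope_half_cube]
    by auto
  then show ?thesis
    by (simp add: convex_closure_rel_interior compact_imp_closed)
qed

text \<open>
The closure of a cell is the face that it came from, so the condition on closures is one on faces.
\<close>

lemma C_cellsE:
  assumes n: "CARD('n) \<ge> 3" and e: "e \<in> (C_cells k :: (real ^ 'n) set set)"
  obtains F where "F face_of half_cube" "F \<noteq> {}" "e = rel_interior F"
    "\<And>v S. \<lbrakk>v \<in> Psi_plus; k \<le> card S\<rbrakk> \<Longrightarrow> F \<noteq> convex hull L_set v S"
proof -
  obtain F where F: "F face_of half_cube" "F \<noteq> {}" "e = rel_interior F"
    using e unfolding C_cells_def cells_eq[OF n] by auto
  moreover have "F \<noteq> convex hull L_set v S" if "v \<in> Psi_plus" "k \<le> card S" for v S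
    using e that closure_rel_interior_face[OF F(1)] by (auto simp: C_cells_def F(3))
  ultimately show ?thesis
    by (rule that)
qed

lemma C_cellsI:
  fixes F :: "(real ^ 'n) set"
  assumes n: "CARD('n) \<ge> 3" and F: "F face_of half_cube" "F \<noteq> {}"
    and not_L: "\<And>v S. \<lbrakk>v \<in> Psi_plus; k \<le> card S\<rbrakk> \<Longrightarrow> F \<noteq> convex hull L_set v S"
  shows "rel_interior F \<in> C_cells k"
  unfolding C_cells_def using F not_L closure_rel_interior_face[OF F(1)]
  by (auto simp: cells_eq[OF n])

lemma WD_image_C:
  fixes g :: "real ^ 'n \<Rightarrow> real ^ 'n"
  assumes n: "CARD('n) \<ge> 3" and g: "g \<in> carrier WD"
  shows "g ` \<Union> (C_cells k) = \<Union> (C_cells k)"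
proof -
  have sub: "g ` \<Union> (C_cells k) \<subseteq> \<Union> (C_cells k)" if g: "g \<in> carrier WD" for g :: "real ^ 'n \<Rightarrow> real ^ 'n"
  proof -
    obtain h where h: "h \<in> carrier WD" "h \<circ> g = id"
      using WD_inverse[OF g] .
    have "g ` e \<in> C_cells k" if e: "e \<in> C_cells k" for e
    proof -
      obtain F where F: "F face_of half_cube" "F \<noteq> {}" "e = rel_interior F"
        and not_L: "\<And>v S. \<lbrakk>v \<in> Psi_plus; k \<le> card S\<rbrakk> \<Longrightarrow> F \<noteq> convex hull L_set v S"
        using C_cellsE[OF n e] by metis
      have lin: "linear g"
        by (rule WD_linear[OF g])
      have "inj g"
        using h(2) by (metis inj_on_id inj_on_imageI2)
      then have "g ` e = rel_interior (g ` F)"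
        using lin F(3) rel_interior_injective_linear_image[of g F] by (simp add: linear_conv_bounded_linear)
      moreover have "g ` F face_of half_cube"
        using half_cube_group_face_of[of g F] g F(1) WD_subset_half_cube_group by blast
      moreover have "g ` F \<noteq> convex hull L_set v S" if "v \<in> Psi_plus" "k \<le> card S" for v S
      proof
        assume eq: "g ` F = convex hull L_set v S"
        obtain T where T: "h v \<in> Psi_plus" "card T = card S"
          "h ` (convex hull L_set v S) = convex hull L_set (h v) T"
          using WD_image_L_set[OF h(1) \<open>v \<in> Psi_plus\<close>, of S] .
        have "F = h ` g ` F"
          using h(2) by (simp add: image_comp)
        then show False
          using T not_L[of "h v" T] that(2) eq by metis
      qed
      ultimately show ?thesis
        using C_cellsI[OF n, of "g ` F"] F(2) by simp
    qed
    then show ?thesis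
      by (simp add: image_Union UN_subset_iff Union_upper)
  qed
  obtain h where h: "h \<in> carrier WD" "g \<circ> h = id"
    using WD_inverse[OF g] .
  have "\<Union> (C_cells k) \<subseteq> g ` \<Union> (C_cells k)"
    using sub[OF h(1)] h(2) by (metis image_comp image_id image_mono id_apply)
  with sub[OF g] show ?thesis
    by blast
qed

lemma WD_homeomorphic_map_C:
  fixes g :: "real ^ 'n \<Rightarrow> real ^ 'n"
  assumes n: "CARD('n) \<ge> 3" and g: "g \<in> carrier WD"
  shows "homeomorphic_map (C_space k) (C_space k) g"
proof -
  obtain h where h: "h \<in> carrier WD" "h \<circ> g = id" "g \<circ> h = id"
    using WD_inverse[OF g] .
  have cont: "continuous_map (C_space k) (C_space k) f" if "f \<in> carrier WD" for f :: "real ^ 'n \<Rightarrow> real ^ 'n"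
    using WD_image_C[OF n that, of k] linear_continuous_on[of f] WD_linear[OF that]
    by (auto simp: C_space_def linear_conv_bounded_linear)
  have "homeomorphic_maps (C_space k) (C_space k) g h"
    unfolding homeomorphic_maps_def using cont g h by (simp add: pointfree_idE)
  then show ?thesis
    using homeomorphic_maps_map by blast
qed

lemma C_homology_group: "group (C_homology p k)"
  by (simp add: C_homology_def)

text \<open>
Functoriality of homology, in the restricted form that makes the induced maps extensional.
\<close>

lemma homology_action_group_hom:
  assumes n: "CARD('n) \<ge> 3"
  shows "group_hom WD (AutoGroup (C_homology p k :: (real ^ 'n) chain set monoid)) (homology_action p k)"
proof -
  let ?H = "C_homology p k :: (real ^ 'n) chain set monoid"
  let ?W = "WD :: (real ^ 'n \<Rightarrow> real ^ 'n) monoid"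
  have homeo: "homeomorphic_map (C_space k) (C_space k) g" if "g \<in> carrier ?W" for g
    using WD_homeomorphic_map_C[OF n that] .
  then have cont: "continuous_map (C_space k) (C_space k) g" if "g \<in> carrier ?W" for g
    using homeomorphic_imp_continuous_map that by blast
  have auto: "homology_action p k g \<in> auto ?H" if g: "g \<in> carrier ?W" for g
  proof -
    let ?f = "hom_induced (int p) (C_space k) {} (C_space k) {} g"
    have "?f \<in> iso ?H ?H"
      unfolding C_homology_def by (rule homeomorphic_map_homology_iso[OF homeo[OF g]])
    then have hom: "?f \<in> hom ?H ?H" and bij: "bij_betw ?f (carrier ?H) (carrier ?H)"
      by (auto simp: iso_def)
    have eq: "?f c = homology_action p k g c" if "c \<in> carrier ?H" for c
      using that by (simp add: homology_action_def)
    have "homology_action p k g \<in> hom ?H ?H"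
      by (rule group.hom_restrict[OF C_homology_group hom]) (rule eq)
    moreover have "bij_betw (homology_action p k g) (carrier ?H) (carrier ?H)"
      unfolding homology_action_def bij_betw_restrict_eq by (rule bij)
    moreover have "homology_action p k g \<in> extensional (carrier ?H)"
      by (simp add: homology_action_def)
    ultimately show ?thesis
      by (simp add: auto_def Bij_def)
  qed
  have "homology_action p k \<in> hom ?W (AutoGroup ?H)"
  proof (rule homI)
    fix g h
    assume g: "g \<in> carrier ?W" and h: "h \<in> carrier ?W"
    have "homology_action p k (g \<circ> h) = compose (carrier ?H) (homology_action p k g) (homology_action p k h)"
    proof
      fix c
      have "hom_induced (int p) (C_space k) {} (C_space k) {} h c \<in> carrier ?H" for c
        unfolding C_homology_def by (rule hom_induced_carrier)
      then show "homology_action p k (g \<circ> h) c = compose (carrier ?H) (homology_action p k g) (homology_action p k h) c"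
        by (simp add: homology_action_def compose_def hom_induced_compose_empty[OF cont[OF h] cont[OF g]])
    qed
    then show "homology_action p k (g \<otimes>\<^bsub>?W\<^esub> h)
        = homology_action p k g \<otimes>\<^bsub>AutoGroup ?H\<^esub> homology_action p k h"
      using auto[OF g] auto[OF h]
      by (simp add: AutoGroup_def BijGroup_def WD_def orthogonal_group_def auto_def)
  qed (simp add: auto AutoGroup_def)
  moreover have "group (AutoGroup ?H)"
    by (rule group.AutoGroup[OF C_homology_group])
  ultimately show ?thesis
    by (simp add: group_hom_def group_hom_axioms_def group_WD)
qed

section \<open>Nontriviality of the homology\<close>

text \<open>
The centroid of the vertices: flipping a coordinate of \<open>S\<close> together with another one permutes the
vertices and reverses the sign of that coordinate, so its average vanishes.
\<close>

lemma L_set_centre: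
  fixes v :: "real ^ 'n"
  assumes v: "v \<in> Psi_plus" and S: "card S \<ge> 2"
  shows "(\<chi> i. if i \<in> S then 0 else v $ i) \<in> convex hull L_set v S" (is "?c \<in> _")
proof -
  let ?L = "L_set v S"
  have fin: "finite ?L"
    using L_set_subset finite_Psi_plus by (rule finite_subset)
  have ne: "?L \<noteq> {}"
    using L_set_self[OF v, of S] by blast
  define m where "m = (\<Sum>w\<in>?L. (1 / card ?L) *\<^sub>R w)"
  have "m \<in> convex hull ?L"
    unfolding m_def using fin ne by (intro convex_sum) (auto intro: hull_inc)
  moreover have "m $ i = ?c $ i" for i
  proof -
    have m: "m $ i = (\<Sum>w\<in>?L. w $ i) / card ?L"
      by (simp add: m_def sum_divide_distrib)
    show ?thesis
    proof (cases "i \<in> S")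
      case False
      then have "(\<Sum>w\<in>?L. w $ i) = (\<Sum>w\<in>?L. v $ i)"
        by (intro sum.cong) (auto simp: L_set_def)
      then show ?thesis
        using False fin ne by (simp add: m)
    next
      case True
      have "card (S - {i}) > 0"
        using S True by simp
      then obtain j where j: "j \<in> S" "j \<noteq> i"
        by (metis Diff_iff card_gt_0_iff ex_in_conv singletonI)
      have closed: "flip {i, j} w \<in> ?L" if "w \<in> ?L" for w
        using that j True by (auto simp: L_set_def flip2_Psi_plus)
      have invol: "flip {i, j} (flip {i, j} w) = w" for w :: "real ^ 'n"
        by (simp add: vec_eq_iff)
      have "bij_betw (flip {i, j}) ?L ?L"
        by (rule bij_betw_byWitness[where f' = "flip {i, j}"]) (use closed invol in auto)
      then have "(\<Sum>w\<in>?L. w $ i) = (\<Sum>w\<in>?L. flip {i, j} w $ i)"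
        by (rule sum.reindex_bij_betw[symmetric])
      also have "\<dots> = - (\<Sum>w\<in>?L. w $ i)"
        by (simp add: sum_negf)
      finally show ?thesis
        using True by (simp add: m)
    qed
  qed
  then have "m = ?c"
    by (simp add: vec_eq_iff)
  ultimately show ?thesis
    by simp
qed

text \<open>
On a face \<open>convex hull K_set v T\<close> every vertex differs from \<open>v\<close> in one coordinate, so
\<open>\<Sum>i\<in>S. v $ i * x $ i\<close> is at least \<open>k - 2\<close>, which is positive.  On a remaining face of type \<open>L\<close> some
coordinate in \<open>S\<close> is fixed at \<open>1\<close> or \<open>- 1\<close>, because there are fewer than \<open>k\<close> free ones.
\<close>

lemma C_nonzero_coordinate:
  fixes x :: "real ^ 'n"
  assumes n: "CARD('n) \<ge> 3" and S: "card S = k" and k: "3 \<le> k" and x: "x \<in> \<Union> (C_cells k)"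
  shows "\<exists>i\<in>S. x $ i \<noteq> 0"
proof -
  obtain F where F: "F face_of half_cube" "F \<noteq> {}" "x \<in> rel_interior F"
    and not_L: "\<And>v S. \<lbrakk>v \<in> Psi_plus; k \<le> card S\<rbrakk> \<Longrightarrow> F \<noteq> convex hull L_set v S"
    using x by (metis UnionE C_cellsE[OF n])
  have xF: "x \<in> F"
    using F(3) rel_interior_subset by blast
  consider v T where "v \<in> Psi_minus" "F = convex hull K_set v T"
    | v T where "v \<in> Psi_plus" "F = convex hull L_set v T"
    using half_cube_faces[OF F(1,2)] by blast
  then show ?thesis
  proof cases
    case 1
    have v: "v \<in> Psi"
      using 1 by (simp add: Psi_minus_iff)
    define a :: "real ^ 'n" where "a = (\<chi> i. if i \<in> S then v $ i else 0)"
    have "(\<Sum>i\<in>S. v $ i * v $ i) = k"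
      by (simp add: Psi_square[OF v] S)
    then have av: "a \<bullet> v = k"
      by (simp add: a_def inner_vec_def if_distrib[of "\<lambda>x. x * _"] sum.If_cases cong: if_cong)
    have "a \<bullet> flip {i} v \<ge> real k - 2" for i
      by (simp add: inner_flip av) (simp add: a_def Psi_square[OF v])
    then have "K_set v T \<subseteq> {y. a \<bullet> y \<ge> real k - 2}"
      using 1(1) by (auto simp: K_set_eq)
    then have "convex hull K_set v T \<subseteq> {y. a \<bullet> y \<ge> real k - 2}"
      by (intro hull_minimal) (auto simp: convex_halfspace_ge)
    then have "real k - 2 \<le> a \<bullet> x"
      using xF unfolding 1(2) by blast
    then have "a \<bullet> x \<noteq> 0"
      using k by linarith
    moreover have "a \<bullet> x = 0" if "\<And>i. i \<in> S \<Longrightarrow> x $ i = 0"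
      unfolding inner_vec_def using that by (intro sum.neutral) (auto simp: a_def)
    ultimately show ?thesis
      by blast
  next
    case 2
    have "\<not> S \<subseteq> T"
      using not_L[OF 2(1), of T] 2(2) S card_mono[of T S] by auto
    then obtain i where i: "i \<in> S" "i \<notin> T"
      by blast
    have "L_set v T \<subseteq> {y. axis i 1 \<bullet> y = v $ i}"
      using i by (auto simp: L_set_def inner_axis')
    then have "convex hull L_set v T \<subseteq> {y. axis i 1 \<bullet> y = v $ i}"
      by (intro hull_minimal) (auto simp: convex_hyperplane)
    then have "x $ i = v $ i"
      using xF 2(2) by (auto simp: inner_axis')
    moreover have "v $ i \<noteq> 0"
      using 2(1) by (simp add: Psi_nonzero Psi_plus_iff)
    ultimately show ?thesis
      using i by (intro bexI[of _ i]) auto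
  qed
qed

text \<open>
Boundary points lie in faces of dimension less than \<open>k\<close>, and the removed faces have dimension at
least \<open>k\<close>.
\<close>

lemma rel_frontier_L_set_subset_C:
  fixes v :: "real ^ 'n"
  assumes n: "CARD('n) \<ge> 3" and v: "v \<in> Psi_plus" and S: "card S = k" and k: "3 \<le> k"
  shows "rel_frontier (convex hull L_set v S) \<subseteq> \<Union> (C_cells k)"
proof
  let ?P = "convex hull L_set v S"
  have P: "polyhedron ?P"
    using face_of_polyhedron_polyhedron[OF polyhedron_half_cube face_L_set[OF v]] .
  fix x
  assume "x \<in> rel_frontier ?P"
  then obtain E where E: "E face_of ?P" "E \<noteq> ?P" "x \<in> E"
    unfolding rel_frontier_of_polyhedron_alt[OF P] by blast
  obtain F where F: "F face_of E" "x \<in> rel_interior F"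
    using face_rel_interior_cover[OF face_of_polyhedron_polyhedron[OF P E(1)] E(3)] .
  have "aff_dim F \<le> aff_dim E"
    by (simp add: F(1) aff_dim_subset face_of_imp_subset)
  also have "aff_dim E < aff_dim ?P"
    using E by (intro face_of_aff_dim_lt) auto
  finally have dim: "aff_dim F < k"
    using aff_dim_L_set[OF v] S k by simp
  have "F face_of half_cube"
    using F(1) E(1) face_L_set[OF v] face_of_trans by blast
  moreover have "F \<noteq> {}"
    using F(2) by auto
  moreover have "F \<noteq> convex hull L_set w T" if "w \<in> Psi_plus" "k \<le> card T" for w T
    using aff_dim_L_set[OF that(1), of T] that k dim by auto
  ultimately show "x \<in> \<Union> (C_cells k)"
    using C_cellsI[OF n, of F k] F(2) by blast
qed

text \<open>
Overwriting the coordinates outside \<open>S\<close> by those of \<open>v\<close> maps the subcomplex to the affine hull of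
\<open>L_set v S\<close> without the centre, which retracts to the relative boundary of the face.
\<close>

lemma C_retraction:
  fixes v :: "real ^ 'n"
  assumes n: "CARD('n) \<ge> 3" and v: "v \<in> Psi_plus" and S: "card S = k" and k: "3 \<le> k"
  shows "\<exists>f. retraction_map (C_space k :: (real ^ 'n) topology) (top_of_set (rel_frontier (convex hull L_set v S))) f"
proof -
  let ?P = "convex hull L_set v S"
  define q :: "real ^ 'n \<Rightarrow> real ^ 'n" where "q x = (\<chi> i. if i \<in> S then x $ i else v $ i)" for x
  define c :: "real ^ 'n" where "c = (\<chi> i. if i \<in> S then 0 else v $ i)"
  have cP: "c \<in> ?P"
    unfolding c_def using L_set_centre[OF v] S k by simp
  have "c \<in> rel_interior ?P"
  proof (rule ccontr)
    assume "c \<notin> rel_interior ?P"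
    with cP have "c \<in> rel_frontier ?P"
      by (simp add: rel_frontier_def closure_subset[THEN subsetD])
    then have "c \<in> \<Union> (C_cells k)"
      using rel_frontier_L_set_subset_C[OF n v S k] by blast
    from C_nonzero_coordinate[OF n S k this] show False
      by (auto simp: c_def)
  qed
  then have "rel_frontier ?P retract_of (affine hull ?P - {c})"
    by (intro rel_frontier_retract_of_punctured_affine_hull bounded_convex_hull)
      (auto intro!: finite_imp_bounded finite_subset[OF L_set_subset])
  then obtain r where r: "retraction (affine hull ?P - {c}) (rel_frontier ?P) r"
    by (auto simp: retract_of_def)
  have aff: "affine hull ?P = {x. \<forall>i. i \<notin> S \<longrightarrow> x $ i = v $ i}"
    using affine_hull_L_set[OF v] S k by simp
  have q: "q ` \<Union> (C_cells k) \<subseteq> affine hull ?P - {c}"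
  proof
    fix y
    assume "y \<in> q ` \<Union> (C_cells k)"
    then obtain x where x: "x \<in> \<Union> (C_cells k)" "y = q x"
      by blast
    obtain i where "i \<in> S" "x $ i \<noteq> 0"
      using C_nonzero_coordinate[OF n S k x(1)] by blast
    then have "y \<noteq> c"
      unfolding x(2) q_def c_def by (auto simp: vec_eq_iff)
    then show "y \<in> affine hull ?P - {c}"
      unfolding aff x(2) by (simp add: q_def)
  qed
  have "continuous_on UNIV (\<lambda>x :: real ^ 'n. if i \<in> S then x $ i else v $ i)" for i
    by (cases "i \<in> S") (auto intro!: continuous_intros)
  then have contq: "continuous_on UNIV q"
    unfolding q_def by (intro continuous_on_vec_lambda)
  have fixed: "q x = x" if "x \<in> rel_frontier ?P" for x
  proof -
    have "x \<in> affine hull ?P"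
      using r that by (auto simp: retraction_def)
    then show ?thesis
      unfolding aff q_def by (auto simp: vec_eq_iff)
  qed
  have sub: "rel_frontier ?P \<subseteq> \<Union> (C_cells k)"
    using rel_frontier_L_set_subset_C[OF n v S k] .
  have "retraction_maps (C_space k) (top_of_set (rel_frontier ?P)) (r \<circ> q) id"
    unfolding retraction_maps_def C_space_def
  proof (intro conjI ballI)
    show "continuous_map (top_of_set (\<Union> (C_cells k))) (top_of_set (rel_frontier ?P)) (r \<circ> q)"
    proof -
      have "continuous_on (\<Union> (C_cells k)) (r \<circ> q)"
        using r q contq by (intro continuous_on_compose)
          (auto simp: retraction_def intro: continuous_on_subset)
      then show ?thesis
        using r q by (auto simp: retraction_def Pi_iff image_subset_iff)
    qed
    show "continuous_map (top_of_set (rel_frontier ?P)) (top_of_set (\<Union> (C_cells k))) id"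
      using sub by auto
  next
    fix x
    assume "x \<in> topspace (top_of_set (rel_frontier ?P))"
    then show "(r \<circ> q) (id x) = x"
      using r fixed by (simp add: retraction_def)
  qed
  then show ?thesis
    unfolding retraction_map_def by (intro exI)
qed

text \<open>
A numbering of \<open>S\<close> identifies the coordinate subspace with the space of sequences that vanish from
index \<open>Suc m\<close> on, in which \<^const>\<open>nsphere\<close> is defined.
\<close>

lemma coord_sphere_homeomorphic_nsphere:
  fixes S :: "'n::finite set"
  assumes S: "card S = Suc m"
  shows "top_of_set (sphere 0 1 \<inter> coord_space S) homeomorphic_space nsphere m"
proof -
  obtain b where b: "bij_betw b {..m} S"
    using finite_same_card_bij[of "{..m}" S] S by auto
  define b' where "b' = inv_into {..m} b"
  have b': "b' (b i) = i" if "i \<le> m" for i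
    using b that by (simp add: b'_def bij_betw_def)
  have bb': "b (b' i) = i" "b' i \<le> m" if "i \<in> S" for i
    using b that bij_betw_inv_into_right[OF b] bij_betwE[OF bij_betw_inv_into[OF b]]
    by (auto simp: b'_def)
  have bS: "b i \<in> S" if "i \<le> m" for i
    using b that by (auto simp: bij_betw_def)
  define f :: "real ^ 'n \<Rightarrow> nat \<Rightarrow> real" where "f x i = (if i \<le> m then x $ b i else 0)" for x i
  define g :: "(nat \<Rightarrow> real) \<Rightarrow> real ^ 'n" where "g y = (\<chi> i. if i \<in> S then y (b' i) else 0)" for y
  have norm: "(norm x)\<^sup>2 = (\<Sum>i\<in>S. (x $ i)\<^sup>2)" if "x \<in> coord_space S" for x
  proof -
    have "(norm x)\<^sup>2 = (\<Sum>i\<in>UNIV. (x $ i)\<^sup>2)"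
      by (simp add: norm_vec_def L2_set_def sum_nonneg)
    also have "\<dots> = (\<Sum>i\<in>S. (x $ i)\<^sup>2)"
      using that by (intro sum.mono_neutral_right) (auto simp: coord_space_def)
    finally show ?thesis .
  qed
  have sphere: "x \<in> sphere 0 1 \<longleftrightarrow> (\<Sum>i\<in>S. (x $ i)\<^sup>2) = 1" if "x \<in> coord_space S" for x
    unfolding norm[OF that, symmetric] by (simp add: power2_eq_1_iff) (smt (verit) norm_ge_zero)
  have sumf: "(\<Sum>i\<le>m. (f x i)\<^sup>2) = (\<Sum>i\<in>S. (x $ i)\<^sup>2)" for x
    using sum.reindex_bij_betw[OF b, of "\<lambda>i. (x $ i)\<^sup>2"] by (simp add: f_def)
  have sumg: "(\<Sum>i\<in>S. (g y $ i)\<^sup>2) = (\<Sum>i\<le>m. (y i)\<^sup>2)" for y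
    using sum.reindex_bij_betw[OF b, of "\<lambda>i. (g y $ i)\<^sup>2"] by (simp add: g_def bS b')
  have top: "topspace (nsphere m) = {x. (\<Sum>i\<le>m. (x i)\<^sup>2) = 1 \<and> (\<forall>i>m. x i = 0)}"
    by (simp add: nsphere)
  have "homeomorphic_maps (top_of_set (sphere 0 1 \<inter> coord_space S)) (nsphere m) f g"
    unfolding homeomorphic_maps_def
  proof (intro conjI ballI)
    show "continuous_map (top_of_set (sphere 0 1 \<inter> coord_space S)) (nsphere m) f"
    proof -
      have "continuous_map (top_of_set (sphere 0 1 \<inter> coord_space S)) (powertop_real UNIV) f"
        unfolding continuous_map_componentwise_UNIV f_def
        by (auto intro!: continuous_intros)
      moreover have "f x \<in> {x. (\<Sum>i\<le>m. (x i)\<^sup>2) = 1 \<and> (\<forall>i>m. x i = 0)}"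
        if "x \<in> sphere 0 1 \<inter> coord_space S" for x
        using that sphere[of x] sumf[of x] by (auto simp: f_def)
      ultimately show ?thesis
        unfolding nsphere by (auto simp: continuous_map_in_subtopology)
    qed
    show "continuous_map (nsphere m) (top_of_set (sphere 0 1 \<inter> coord_space S)) g"
    proof -
      have "continuous_on UNIV (\<lambda>y :: nat \<Rightarrow> real. if i \<in> S then y (b' i) else 0)" for i
        by (cases "i \<in> S") auto
      then have "continuous_on UNIV g"
        unfolding g_def by (intro continuous_on_vec_lambda)
      then have "continuous_map (nsphere m) euclidean g"
        unfolding nsphere euclidean_product_topology
        by (auto intro: continuous_on_subset)
      moreover have "g y \<in> sphere 0 1 \<inter> coord_space S" if "y \<in> topspace (nsphere m)" for y
      proof -
        have "g y \<in> coord_space S"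
          by (simp add: g_def coord_space_def)
        then show ?thesis
          using that sphere[of "g y"] by (simp add: top sumg del: mem_sphere)
      qed
      ultimately show ?thesis
        by (auto simp: continuous_map_in_subtopology)
    qed
  next
    fix x
    assume "x \<in> topspace (top_of_set (sphere 0 1 \<inter> coord_space S))"
    then show "g (f x) = x"
      by (auto simp: g_def f_def vec_eq_iff coord_space_def bb')
  next
    fix y
    assume "y \<in> topspace (nsphere m)"
    then show "f (g y) = y"
      by (auto simp: g_def f_def fun_eq_iff top bS b')
  qed
  then show ?thesis
    using homeomorphic_space_def by blast
qed

text \<open>
Bounded convex sets of the same dimension have homeomorphic relative boundaries; the comparison is
with the unit ball of the coordinate subspace.
\<close>

lemma rel_frontier_L_set_sphere:
  fixes v :: "real ^ 'n"
  assumes v: "v \<in> Psi_plus" and S: "card S = Suc m" and m: "2 \<le> m"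
  shows "top_of_set (rel_frontier (convex hull L_set v S)) homeomorphic_space nsphere m"
proof -
  let ?B = "cball 0 1 \<inter> coord_space S"
  have aff: "affine (coord_space S)"
    using subspace_coord_space subspace_imp_affine by blast
  have 0: "0 \<in> interior (cball 0 1) \<inter> coord_space S"
    by (simp add: interior_cball coord_space_def)
  have "rel_frontier ?B = sphere 0 1 \<inter> coord_space S"
  proof -
    have "interior (cball 0 1) \<inter> coord_space S \<noteq> {}"
      using 0 by blast
    from convex_affine_rel_frontier_Int[OF _ aff this] show ?thesis
      by simp
  qed
  moreover have "aff_dim (coord_space S \<inter> cball 0 1) = aff_dim (coord_space S)"
    using 0 aff by (intro aff_dim_convex_Int_nonempty_interior affine_imp_convex) auto
  then have "aff_dim ?B = int (card S)"
    by (simp add: Int_commute aff_dim_subspace subspace_coord_space dim_coord_space)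
  moreover have "aff_dim (convex hull L_set v S) = int (card S)"
    using aff_dim_L_set[OF v] S m by simp
  moreover have "bounded (convex hull L_set v S)"
    by (intro bounded_convex_hull finite_imp_bounded finite_subset[OF L_set_subset]) simp
  moreover have "convex ?B" "bounded ?B"
    using aff by (auto intro: convex_Int affine_imp_convex bounded_Int)
  ultimately have "rel_frontier (convex hull L_set v S) homeomorphic (sphere 0 1 \<inter> coord_space S)"
    using homeomorphic_rel_frontiers_convex_bounded_sets[of "convex hull L_set v S" ?B] by simp
  then have "top_of_set (rel_frontier (convex hull L_set v S))
      homeomorphic_space top_of_set (sphere 0 1 \<inter> coord_space S)"
    by simp
  also have "\<dots> homeomorphic_space nsphere m"
    by (rule coord_sphere_homeomorphic_nsphere[OF S])
  finally show ?thesis .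
qed

text \<open>
A retraction induces a surjection in homology.  Since \<open>k - 1 \<ge> 2\<close>, reduced and unreduced homology
agree in degree \<open>k - 1\<close>.
\<close>

lemma nontrivial_C_homology:
  assumes n: "k \<le> CARD('n)" and k: "3 \<le> k"
  shows "\<not> trivial_group (C_homology (k - 1) k :: (real ^ 'n) chain set monoid)"
proof
  assume triv: "trivial_group (C_homology (k - 1) k :: (real ^ 'n) chain set monoid)"
  obtain S :: "'n set" where S: "card S = k"
    using obtain_subset_with_card_n[of k "UNIV :: 'n set"] n by auto
  define m where "m = k - 1"
  have m: "k = Suc m" "2 \<le> m"
    using k by (auto simp: m_def)
  let ?Y = "top_of_set (rel_frontier (convex hull L_set (1 :: real ^ 'n) S))"
  let ?C = "C_space k :: (real ^ 'n) topology"
  obtain f where f: "retraction_map ?C ?Y f"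
    using C_retraction[OF _ one_Psi_plus S k] n k by (meson le_trans)
  obtain c where "carrier (homology_group (int m) ?C) = {c}"
    using triv by (auto simp: C_homology_def trivial_group_def m_def)
  with surj_hom_induced_retraction_map[OF f, of "int m"]
  obtain d where "carrier (homology_group (int m) ?Y) = {d}"
    by auto
  then have "trivial_group (homology_group (int m) ?Y)"
    by (metis group.trivial_group group_relative_homology_group)
  moreover have "homology_group (int m) ?Y \<cong> homology_group (int m) (nsphere m)"
    using rel_frontier_L_set_sphere[OF one_Psi_plus, of S m] S m
    by (intro homeomorphic_space_imp_isomorphic_homology_groups) simp
  ultimately have "trivial_group (homology_group (int m) (nsphere m))"
    using isomorphic_group_triviality by (metis group_relative_homology_group)
  then have "trivial_group (reduced_homology_group (int m) (nsphere m))"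
    using m by (simp add: un_reduced_homology_group)
  then show False
    by (simp add: trivial_reduced_homology_group_nsphere)
qed

theorem theorem4p2p3:
  fixes G W :: "(real ^ 'n \<Rightarrow> real ^ 'n) monoid" and n :: nat
  defines "G \<equiv> half_cube_group" and "W \<equiv> WD" and "n \<equiv> CARD('n)"
  assumes n_ge_4: "n \<ge> 4"
  shows
    "(group G \<and> subgroup (carrier W) G)
   \<and> (\<forall>k\<le>n. group_action G (k_faces k) (face_action k)
           \<and> group_action W (k_faces k) (face_action k))
   \<and> (n > 4 \<longrightarrow>
        (\<forall>k\<le>n. orbits G (k_faces k) (face_action k) = orbits W (k_faces k) (face_action k)
           \<and> (if 3 \<le> k \<and> k < n
              then card (orbits G (k_faces k) (face_action k)) = 2
                 \<and> orbits G (k_faces k) (face_action k) = {K_faces k, L_faces k}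
              else card (orbits G (k_faces k) (face_action k)) = 1)))
   \<and> (n = 4 \<longrightarrow>
        (\<forall>k\<le>n. card (orbits G (k_faces k) (face_action k)) = 1
           \<and> (if k = 3
              then card (orbits W (k_faces k) (face_action k)) = 2
                 \<and> orbits W (k_faces k) (face_action k) = {K_faces k, L_faces k}
              else orbits W (k_faces k) (face_action k) = orbits G (k_faces k) (face_action k))))
   \<and> (\<forall>k. 3 \<le> k \<and> k \<le> n \<longrightarrow>
        \<not> trivial_group (C_homology (k - 1) k :: (real ^ 'n) chain set monoid)
      \<and> (\<forall>g\<in>carrier W. homeomorphic_map (C_space k) (C_space k) g)
      \<and> group_hom W (AutoGroup (C_homology (k - 1) k)) (homology_action (k - 1) k))"
proof (intro conjI)
  show "group G" "subgroup (carrier W) G"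
    unfolding G_def W_def by (rule group_half_cube_group subgroup_WD_half_cube_group)+
  show "\<forall>k\<le>n. group_action G (k_faces k) (face_action k) \<and> group_action W (k_faces k) (face_action k)"
    unfolding G_def W_def by (simp add: group_action_half_cube_group group_action_WD)
  have two: "card {K_faces k, L_faces k :: (real ^ 'n) set set} = 2"
    if "3 \<le> k" "k \<le> n" for k
  proof -
    have "L_faces k \<noteq> ({} :: (real ^ 'n) set set)"
      using that L_faces_nonempty[where 'n = 'n] by (simp add: n_def)
    moreover have "K_faces k \<inter> L_faces k = ({} :: (real ^ 'n) set set)"
      using that by (intro K_faces_Int_L_faces) simp
    ultimately have "K_faces k \<noteq> (L_faces k :: (real ^ 'n) set set)"
      by blast
    then show ?thesis
      by simp
  qed
  have W: "orbits W (k_faces k) (face_action k)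
      = (if 3 \<le> k \<and> k < n then {K_faces k, L_faces k} else {k_faces k})"
    if "k \<le> n" for k
    using that n_ge_4 orbits_WD[where 'n = 'n, of k] K_faces_top[where 'n = 'n]
    by (auto simp: W_def n_def k_faces_eq)
  show "n > 4 \<longrightarrow>
        (\<forall>k\<le>n. orbits G (k_faces k) (face_action k) = orbits W (k_faces k) (face_action k)
           \<and> (if 3 \<le> k \<and> k < n
              then card (orbits G (k_faces k) (face_action k)) = 2
                 \<and> orbits G (k_faces k) (face_action k) = {K_faces k, L_faces k}
              else card (orbits G (k_faces k) (face_action k)) = 1))"
  proof (intro impI allI)
    fix k
    assume n4: "n > 4" and k: "k \<le> n"
    have "orbits G (k_faces k) (face_action k) = orbits W (k_faces k) (face_action k)"
      using orbits_half_cube_group[where 'n = 'n, of k] n4 k by (simp add: G_def W_def n_def)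
    with W[OF k] two[of k] k
    show "orbits G (k_faces k) (face_action k) = orbits W (k_faces k) (face_action k)
           \<and> (if 3 \<le> k \<and> k < n
              then card (orbits G (k_faces k) (face_action k)) = 2
                 \<and> orbits G (k_faces k) (face_action k) = {K_faces k, L_faces k}
              else card (orbits G (k_faces k) (face_action k)) = 1)"
      by simp
  qed
  show "n = 4 \<longrightarrow>
        (\<forall>k\<le>n. card (orbits G (k_faces k) (face_action k)) = 1
           \<and> (if k = 3
              then card (orbits W (k_faces k) (face_action k)) = 2
                 \<and> orbits W (k_faces k) (face_action k) = {K_faces k, L_faces k}
              else orbits W (k_faces k) (face_action k) = orbits G (k_faces k) (face_action k)))"
  proof (intro impI allI)
    fix k
    assume n4: "n = 4" and k: "k \<le> n"
    have "orbits G (k_faces k) (face_action k) = {k_faces k}"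
      using orbits_half_cube_group_4[where 'n = 'n, of k] n4 k by (simp add: G_def n_def)
    moreover have eq: "3 \<le> k \<and> k < n \<longleftrightarrow> k = 3"
      using n4 by auto
    moreover have "orbits W (k_faces k) (face_action k)
        = (if k = 3 then {K_faces k, L_faces k} else {k_faces k})"
      using W[OF k] unfolding eq .
    ultimately show "card (orbits G (k_faces k) (face_action k)) = 1
           \<and> (if k = 3
              then card (orbits W (k_faces k) (face_action k)) = 2
                 \<and> orbits W (k_faces k) (face_action k) = {K_faces k, L_faces k}
              else orbits W (k_faces k) (face_action k) = orbits G (k_faces k) (face_action k))"
      using two[of k] k by (cases "k = 3") simp_all
  qed
  show "\<forall>k. 3 \<le> k \<and> k \<le> n \<longrightarrow>
        \<not> trivial_group (C_homology (k - 1) k :: (real ^ 'n) chain set monoid)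
      \<and> (\<forall>g\<in>carrier W. homeomorphic_map (C_space k) (C_space k) g)
      \<and> group_hom W (AutoGroup (C_homology (k - 1) k)) (homology_action (k - 1) k)"
    using nontrivial_C_homology[where 'n = 'n] WD_homeomorphic_map_C[where 'n = 'n]
      homology_action_group_hom[where 'n = 'n] n_ge_4
    unfolding W_def n_def by simp
qed

end
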